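(* Let $f\in\mathbb{Z}[X]$ be a monic irreducible polynomial of degree $n\ge 2$, let $\theta$ be a root of $f$, let $K=\mathbb{Q}(\theta)$ with ring of integers $\mathcal{O}_K$, and let $\mathfrak{C}_\theta$ be the conductor of $\mathbb{Z}[\theta]$ in $\mathcal{O}_K$. Let $p$ be a prime number and let $r\in\mathbb{Z}$ satisfy: (i) $p^2\nmid f(r)$; (ii) $p\nmid f''(r)$; (iii) every maximal ideal $\mathfrak{m}$ of $\mathcal{O}_K$ with $\mathfrak{C}_\theta\subseteq\mathfrak{m}$ and $p\in\mathfrak{m}$ contains $\theta-r$. Then $\mathbb{Z}[\theta]$ is $p$-maximal.
   Context: The conductor of $\mathbb{Z}[\theta]$ is $\mathfrak{C}_\theta=\{x\in\mathcal{O}_K : x\mathcal{O}_K\subseteq\mathbb{Z}[\theta]\}$. For a prime $p$, the order $\mathbb{Z}[\theta]$ is called $p$-maximal if $p\nmid I(\theta)$, where $I(\theta)=[\mathcal{O}_K:\mathbb{Z}[\theta]]$ is the index. Here $f''$ is the formal second derivative of $f$. *)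

theory Defs
  imports "HOL-Algebra.Algebra" "HOL-Algebra.Algebraic_Closure_Type"
begin

text \<open>
  The root \<open>\<theta>\<close> lives in an arbitrary type of class \<^class>\<open>field_char_0\<close>; the number field
  \<open>\<rat>(\<theta>)\<close>, its ring of integers and \<open>\<int>[\<theta>]\<close> are subsets of that type. The constant
  \<^const>\<open>ring_of_type_algebra\<close> is the type itself seen as a HOL-Algebra ring.
\<close>

definition number_field :: "'a::field_char_0 \<Rightarrow> 'a set" where
  "number_field \<theta> = generate_field ring_of_type_algebra {\<theta>}"

definition ring_of_integers :: "'a::field_char_0 set \<Rightarrow> 'a ring" where
  "ring_of_integers K = ring_of_type_algebra \<lparr>carrier := {x \<in> K. algebraic_int x}\<rparr>"

definition monogenic_order :: "'a::field_char_0 \<Rightarrow> 'a set" where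
  "monogenic_order \<theta> = generate_ring ring_of_type_algebra {\<theta>}"

definition conductor :: "'a::field_char_0 \<Rightarrow> 'a set" where
  "conductor \<theta> =
    {x \<in> carrier (ring_of_integers (number_field \<theta>)).
       (\<lambda>y. x * y) ` carrier (ring_of_integers (number_field \<theta>)) \<subseteq> monogenic_order \<theta>}"

text \<open>
  The index counts additive cosets. As \<^const>\<open>card\<close> is \<open>0\<close> on infinite sets, an infinite index
  would be divisible by every \<open>p\<close>; so \<open>p_maximal\<close> implies that the index is finite.
\<close>

definition order_index :: "'a::field_char_0 \<Rightarrow> nat" where
  "order_index \<theta> =
    card (a_rcosets\<^bsub>ring_of_integers (number_field \<theta>)\<^esub> (monogenic_order \<theta>))"

definition p_maximal :: "nat \<Rightarrow> 'a::field_char_0 \<Rightarrow> bool" where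
  "p_maximal p \<theta> \<longleftrightarrow> \<not> p dvd order_index \<theta>"

end

theory Submission
  imports Defs "Jordan_Normal_Form.Char_Poly"
begin

text \<open>
  Write \<open>A = \<int>[\<theta>]\<close>, \<open>t = \<theta> - r\<close>, and let \<open>C\<close> be the conductor. The index is finite because the
  coefficients of an algebraic integer \<open>G(\<theta>)\<close> with \<open>deg G < n\<close> are recovered by interpolation from
  its conjugates with a denominator that depends only on \<open>f\<close>. So, by Cauchy's theorem, it suffices that
  \<open>\<O>\<^sub>K / A\<close> has no \<open>p\<close>-torsion.

  Since \<open>A / pA\<close> is finite, some power \<open>e\<close> of \<open>t\<close> is idempotent modulo \<open>pA\<close>. A maximal ideal
  containing \<open>C + p\<O>\<^sub>K + (1 - e)\<O>\<^sub>K\<close> would contain \<open>t\<close> by (iii), hence \<open>e\<close> and \<open>1\<close>; so that ideal is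
  the unit ideal and \<open>e \<in> C + p\<O>\<^sub>K\<close>. Consequently \<open>t\<close> acts nilpotently on the \<open>p\<close>-torsion of
  \<open>\<O>\<^sub>K / A\<close>, and it is enough to treat an integral \<open>u\<close> with \<open>pu = g(\<theta>)\<close> and \<open>tu = h(\<theta>)\<close>, where
  \<open>deg g, deg h < n\<close>. Then \<open>(X - r) g - p h = c f\<close> for an integer \<open>c\<close>. If \<open>p\<close> divides \<open>c\<close>, it
  divides \<open>g\<close>, and \<open>u \<in> A\<close>. Otherwise \<open>X = r\<close> gives \<open>p h(r) = - c f(r)\<close>, so \<open>p\<close> divides \<open>f(r)\<close>
  exactly once and does not divide \<open>h(r)\<close>. But homogenising a monic equation of degree \<open>k\<close> for \<open>u\<close> by
  \<open>t\<close> and evaluating at \<open>r\<close> shows that \<open>f(r)\<close> divides \<open>h(r)^k\<close>, a contradiction.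
\<close>

section \<open>Algebraic integers\<close>

text \<open>The determinant trick: the values \<open>v\<close> form a nonzero eigenvector of the
  integer matrix \<open>c\<close> for the eigenvalue \<open>z\<close>, so \<open>z\<close> is a root
  of the characteristic polynomial, which is monic with integer coefficients.\<close>

lemma algebraic_int_if_stable_vec:
  fixes z :: "'a::field_char_0" and v :: "nat \<Rightarrow> 'a" and c :: "nat \<Rightarrow> nat \<Rightarrow> int"
  assumes stable: "\<And>i. i < n \<Longrightarrow> z * v i = (\<Sum>j<n. of_int (c i j) * v j)"
    and "i0 < n" "v i0 \<noteq> 0"
  shows "algebraic_int z"
proof -
  define A where "A = Matrix.mat n n (\<lambda>(i, j). c i j)"
  define w where "w = Matrix.vec n v"
  have A: "A \<in> carrier_mat n n"
    by (simp add: A_def)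
  have "map_mat of_int A *\<^sub>v w = z \<cdot>\<^sub>v w"
    by (rule eq_vecI) (auto simp: A_def w_def stable scalar_prod_def lessThan_atLeast0)
  moreover have "w \<noteq> 0\<^sub>v n"
    using assms(2,3) by (metis index_vec index_zero_vec(1) w_def)
  ultimately have "eigenvalue (map_mat of_int A) z"
    using A unfolding eigenvalue_def eigenvector_def
    by (intro exI[of _ w]) (auto simp: w_def)
  then have "poly (char_poly (map_mat of_int A)) z = 0"
    by (subst (asm) eigenvalue_root_char_poly[where n = n]) (use A in auto)
  then have "poly (map_poly of_int (char_poly A)) z = 0"
    by (simp add: of_int_hom.char_poly_hom[OF A])
  moreover have "Polynomial.lead_coeff (char_poly A) = 1"
    using degree_monic_char_poly[OF A] by simp
  ultimately show ?thesis
    unfolding algebraic_int_altdef_ipoly by blast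
qed

section \<open>Modules spanned over the integers\<close>

definition int_span :: "'i set \<Rightarrow> ('i \<Rightarrow> 'a::comm_ring_1) \<Rightarrow> 'a set" where
  "int_span I v = range (\<lambda>c. \<Sum>i\<in>I. of_int (c i) * v i)"

lemma int_spanI: "x = (\<Sum>i\<in>I. of_int (c i) * v i) \<Longrightarrow> x \<in> int_span I v"
  by (auto simp: int_span_def)

lemma int_span_base:
  assumes "finite I" "i \<in> I" shows "v i \<in> int_span I v"
proof -
  have "v i = (\<Sum>j\<in>I. of_int (if j = i then 1 else 0) * v j)"
    using assms by (simp add: if_distrib[of of_int] if_distrib[of "\<lambda>x. x * _"] sum.delta cong: if_cong)
  then show ?thesis by (rule int_spanI)
qed

lemma int_span_0: "0 \<in> int_span I v"
  by (rule int_spanI[where c = "\<lambda>_. 0"]) simp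

lemma int_span_add:
  assumes "x \<in> int_span I v" "y \<in> int_span I v" shows "x + y \<in> int_span I v"
proof -
  obtain c d where "x = (\<Sum>i\<in>I. of_int (c i) * v i)" "y = (\<Sum>i\<in>I. of_int (d i) * v i)"
    using assms by (auto simp: int_span_def)
  then have "x + y = (\<Sum>i\<in>I. of_int (c i + d i) * v i)"
    by (simp add: sum.distrib distrib_right)
  then show ?thesis by (rule int_spanI)
qed

lemma int_span_scale:
  assumes "x \<in> int_span I v" shows "of_int k * x \<in> int_span I v"
proof -
  obtain c where "x = (\<Sum>i\<in>I. of_int (c i) * v i)"
    using assms by (auto simp: int_span_def)
  then have "of_int k * x = (\<Sum>i\<in>I. of_int (k * c i) * v i)"
    by (simp add: sum_distrib_left mult.assoc)
  then show ?thesis by (rule int_spanI)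
qed

lemma int_span_sum:
  "(\<And>j. j \<in> J \<Longrightarrow> f j \<in> int_span I v) \<Longrightarrow> sum f J \<in> int_span I v"
  by (induction J rule: infinite_finite_induct) (auto intro: int_span_0 int_span_add)

lemma int_span_mult:
  assumes "\<And>i. i \<in> I \<Longrightarrow> z * v i \<in> int_span I v" and "x \<in> int_span I v"
  shows "z * x \<in> int_span I v"
proof -
  obtain c where "x = (\<Sum>i\<in>I. of_int (c i) * v i)"
    using assms by (auto simp: int_span_def)
  then have "z * x = (\<Sum>i\<in>I. of_int (c i) * (z * v i))"
    by (simp add: sum_distrib_left mult_ac)
  then show ?thesis by (auto intro!: int_span_sum int_span_scale assms)
qed

text \<open>The module form of the determinant trick, for an arbitrary finite index set: numbering
  \<open>I\<close> turns the coefficients of the products into an integer matrix. The nonzero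
  generator makes the eigenvector nonzero.\<close>

lemma algebraic_int_if_stable:
  fixes z :: "'a::field_char_0"
  assumes "finite I" and stable: "\<And>i. i \<in> I \<Longrightarrow> z * v i \<in> int_span I v"
    and "i0 \<in> I" "v i0 \<noteq> 0"
  shows "algebraic_int z"
proof -
  obtain e where e: "bij_betw e {..<card I} I"
    using ex_bij_betw_nat_finite[OF \<open>finite I\<close>] by (auto simp: lessThan_atLeast0)
  from stable have "\<forall>i\<in>I. \<exists>c. z * v i = (\<Sum>j\<in>I. of_int (c j) * v j)"
    by (auto simp: int_span_def image_iff)
  then obtain c where c: "\<And>i. i \<in> I \<Longrightarrow> z * v i = (\<Sum>j\<in>I. of_int (c i j) * v j)"
    by metis
  obtain k where "k < card I" "e k = i0"
    using e \<open>i0 \<in> I\<close> by (force simp: bij_betw_def)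
  moreover have "z * v (e i) = (\<Sum>j<card I. of_int (c (e i) (e j)) * v (e j))" if "i < card I" for i
    using c[of "e i"] that e
    by (auto simp: bij_betw_def sum.reindex_bij_betw[OF e, of "\<lambda>j. of_int (c (e i) j) * v j"])
  ultimately show ?thesis
    using \<open>v i0 \<noteq> 0\<close> by (intro algebraic_int_if_stable_vec[of "card I" z "\<lambda>i. v (e i)"]) auto
qed

section \<open>Closure of the algebraic integers under ring operations\<close>

lemma power_in_int_span:
  fixes x :: "'a::field_char_0"
  assumes "poly (map_poly of_int p) x = 0" "Polynomial.lead_coeff p = 1" "Polynomial.degree p = n"
  shows "x ^ n \<in> int_span {..<n} (\<lambda>i. x ^ i)"
proof -
  have "0 = (\<Sum>i\<le>n. of_int (Polynomial.coeff p i) * x ^ i)"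
    using assms by (simp add: poly_altdef)
  also have "\<dots> = (\<Sum>i<n. of_int (Polynomial.coeff p i) * x ^ i) + x ^ n"
    using assms by (simp flip: lessThan_Suc_atMost)
  finally have "x ^ n = (\<Sum>i<n. of_int (- Polynomial.coeff p i) * x ^ i)"
    by (simp add: sum_negf add_eq_0_iff2)
  then show ?thesis by (rule int_spanI)
qed

text \<open>The monomials \<open>x ^ i * y ^ j\<close> with exponents below the degrees of monic
  equations for \<open>x\<close> and \<open>y\<close> span a module stable under both
  \<open>x\<close> and \<open>y\<close>, hence under their sum and product.\<close>

lemma algebraic_int_plus_times:
  fixes x y :: "'a::field_char_0"
  assumes "algebraic_int x" "algebraic_int y"
  shows algebraic_int_plus: "algebraic_int (x + y)"
    and algebraic_int_times: "algebraic_int (x * y)"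
proof -
  obtain p where p: "poly (map_poly of_int p) x = 0" "Polynomial.lead_coeff p = 1"
    using assms(1) by (auto simp: algebraic_int_altdef_ipoly)
  obtain q where q: "poly (map_poly of_int q) y = 0" "Polynomial.lead_coeff q = 1"
    using assms(2) by (auto simp: algebraic_int_altdef_ipoly)
  define m n where "m = Polynomial.degree p" and "n = Polynomial.degree q"
  \<comment> \<open>Both degrees must be positive so that the exponent pair \<open>(0, 0)\<close>
    lies in \<open>I\<close>; its monomial 1 is the required nonzero generator.\<close>
  have pos: "Polynomial.degree g \<noteq> 0"
    if "poly (map_poly of_int g) z = 0" "Polynomial.lead_coeff g = 1" for g and z :: 'a
  proof
    assume "Polynomial.degree g = 0"
    then obtain a where "g = [:a:]" by (rule degree_eq_zeroE)
    with that show False by simp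
  qed
  have "m \<noteq> 0" "n \<noteq> 0"
    using pos p q by (auto simp: m_def n_def)
  define I where "I = {..<m} \<times> {..<n}"
  define v where "v = (\<lambda>(i, j). x ^ i * y ^ j)"
  have fin: "finite I" by (simp add: I_def)
  have x: "x * v k \<in> int_span I v" if k_in: "k \<in> I" for k
  proof -
    obtain i j where k: "k = (i, j)" "i < m" "j < n" using k_in by (auto simp: I_def)
    show ?thesis
    proof (cases "Suc i < m")
      case True
      then have "v (Suc i, j) \<in> int_span I v" using k by (intro int_span_base fin) (auto simp: I_def)
      then show ?thesis by (simp add: k v_def mult_ac)
    next
      case False
      then have "Suc i = m" using k by simp
      \<comment> \<open>The exponent leaves the box, so the monic equation of \<open>x\<close>
        rewrites the top power through lower ones.\<close>
      obtain c where c: "x ^ m = (\<Sum>i<m. of_int (c i) * x ^ i)"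
        using power_in_int_span[OF p m_def[symmetric]] by (auto simp: int_span_def)
      have "x * v k = x ^ m * y ^ j" by (simp add: k v_def mult_ac flip: \<open>Suc i = m\<close>)
      also have "\<dots> = (\<Sum>i<m. of_int (c i) * v (i, j))"
        by (simp add: c v_def sum_distrib_left mult_ac)
      finally show ?thesis
        using k by (auto simp: I_def intro!: int_span_sum int_span_scale int_span_base)
    qed
  qed
  have y: "y * v k \<in> int_span I v" if k_in: "k \<in> I" for k
  proof -
    obtain i j where k: "k = (i, j)" "i < m" "j < n" using k_in by (auto simp: I_def)
    show ?thesis
    proof (cases "Suc j < n")
      case True
      then have "v (i, Suc j) \<in> int_span I v" using k by (intro int_span_base fin) (auto simp: I_def)
      then show ?thesis by (simp add: k v_def mult_ac)
    next
      case False
      then have "Suc j = n" using k by simp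
      obtain c where c: "y ^ n = (\<Sum>i<n. of_int (c i) * y ^ i)"
        using power_in_int_span[OF q n_def[symmetric]] by (auto simp: int_span_def)
      have "y * v k = x ^ i * y ^ n" by (simp add: k v_def mult_ac flip: \<open>Suc j = n\<close>)
      also have "\<dots> = (\<Sum>j<n. of_int (c j) * v (i, j))"
        by (simp add: c v_def sum_distrib_left mult_ac)
      finally show ?thesis
        using k by (auto simp: I_def intro!: int_span_sum int_span_scale int_span_base)
    qed
  qed
  have one: "(0, 0) \<in> I" "v (0, 0) \<noteq> 0"
    using \<open>m \<noteq> 0\<close> \<open>n \<noteq> 0\<close> by (auto simp: I_def v_def)
  show "algebraic_int (x + y)"
    using fin _ one(1) one(2)
  proof (rule algebraic_int_if_stable)
    show "(x + y) * v k \<in> int_span I v" if "k \<in> I" for k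
      using x[OF that] y[OF that] by (simp add: distrib_right int_span_add)
  qed
  show "algebraic_int (x * y)"
    using fin _ one(1) one(2)
  proof (rule algebraic_int_if_stable)
    show "x * y * v k \<in> int_span I v" if "k \<in> I" for k
      using int_span_mult[OF x y[OF that]] by (simp add: mult.assoc)
  qed
qed

lemma algebraic_int_diff:
  fixes x y :: "'a::field_char_0"
  assumes "algebraic_int x" "algebraic_int y"
  shows "algebraic_int (x - y)"
  using algebraic_int_plus[of x "- y"] assms by auto

lemma algebraic_int_power:
  fixes x :: "'a::field_char_0"
  shows "algebraic_int x \<Longrightarrow> algebraic_int (x ^ k)"
  by (induction k) (auto intro: algebraic_int_times)

lemma algebraic_int_sum:
  fixes f :: "'b \<Rightarrow> 'a::field_char_0"
  shows "(\<And>i. i \<in> S \<Longrightarrow> algebraic_int (f i)) \<Longrightarrow> algebraic_int (sum f S)"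
  by (induction S rule: infinite_finite_induct) (auto intro: algebraic_int_plus)

lemma algebraic_int_prod:
  fixes f :: "'b \<Rightarrow> 'a::field_char_0"
  shows "(\<And>i. i \<in> S \<Longrightarrow> algebraic_int (f i)) \<Longrightarrow> algebraic_int (prod f S)"
  by (induction S rule: infinite_finite_induct) (auto intro: algebraic_int_times)

lemma algebraic_int_ipoly:
  fixes x :: "'a::field_char_0"
  assumes "algebraic_int x"
  shows "algebraic_int (poly (map_poly of_int p) x)"
  by (auto simp: poly_altdef intro!: algebraic_int_sum algebraic_int_times algebraic_int_power assms)

text \<open>As \<open>x\<close> is nonzero, zero constant coefficients can be stripped from an
  equation for \<open>x\<close>. The first nonzero one is \<open>N\<close>, and the rest of the
  equation, up to sign, is a multiple of \<open>x\<close>. This serves to invert elements and to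
  turn integral denominators into integer ones.\<close>

lemma algebraic_int_divides_int:
  fixes x :: "'a::field_char_0"
  assumes "algebraic_int x" "x \<noteq> 0"
  obtains s :: "int poly" and N :: int where "N \<noteq> 0" "x * poly (map_poly of_int s) x = of_int N"
proof -
  have "\<exists>s N. N \<noteq> 0 \<and> x * poly (map_poly of_int s) x = of_int N"
    if "p \<noteq> 0" "poly (map_poly of_int p) x = 0" for p
    using that
  proof (induction p)
    case 0
    then show ?case by simp
  next
    case (pCons a p)
    show ?case
    proof (cases "a = 0")
      case True
      then show ?thesis using pCons \<open>x \<noteq> 0\<close> by auto
    next
      case False
      then show ?thesis using pCons.prems
        by (intro exI[of _ "- p"] exI[of _ a])
          (auto simp: of_int_hom.map_poly_pCons_hom of_int_poly_hom.hom_uminus add_eq_0_iff2)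
    qed
  qed
  moreover obtain p :: "int poly" where "poly (map_poly of_int p) x = 0" "Polynomial.lead_coeff p = 1"
    using assms(1) unfolding algebraic_int_altdef_ipoly by blast
  moreover from this have "p \<noteq> 0" by auto
  ultimately show thesis
    using that by blast
qed

section \<open>Roots of irreducible integer polynomials\<close>

text \<open>Let \<open>m\<close> be nonzero of least degree vanishing at \<open>x\<close>.
  Pseudo-division replaces Euclidean division, so every polynomial vanishing at \<open>x\<close> is
  a multiple of \<open>m\<close> up to a nonzero integer factor. Irreducible elements of the
  factorial ring of integer polynomials are prime, which allows these factors to be removed.\<close>

lemma irreducible_int_poly_dvd_if_root:
  fixes f g :: "int poly" and x :: "'a::field_char_0"
  assumes "Factorial_Ring.irreducible f" "Polynomial.degree f > 0"
    and "poly (map_poly of_int f) x = 0" and "poly (map_poly of_int g) x = 0"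
  shows "f dvd g"
proof -
  define m where "m = (ARG_MIN Polynomial.degree m. m \<noteq> 0 \<and> poly (map_poly of_int m) x = 0)"
  have "f \<noteq> 0"
    using assms by auto
  with assms(3) have m: "m \<noteq> 0" "poly (map_poly of_int m) x = 0"
    using arg_min_natI[of "\<lambda>m. m \<noteq> 0 \<and> poly (map_poly of_int m) x = 0" f Polynomial.degree]
    by (auto simp: m_def)
  have min: "Polynomial.degree m \<le> Polynomial.degree h"
    if "h \<noteq> 0" "poly (map_poly of_int h) x = 0" for h
    unfolding m_def using that by (intro arg_min_nat_le) auto
  have multiple: "\<exists>a q. a \<noteq> 0 \<and> Polynomial.smult a h = m * q"
    if h: "poly (map_poly of_int h) x = 0" for h
  proof -
    define r where "r = pseudo_mod h m"
    obtain a q where aq: "a \<noteq> 0" "Polynomial.smult a h = m * q + r"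
      using pseudo_mod(1)[OF m(1), of h] by (auto simp: r_def)
    have "r = Polynomial.smult a h - m * q"
      using aq by simp
    then have "poly (map_poly of_int r) x = 0"
      using h m by (simp add: of_int_poly_hom.hom_minus of_int_poly_hom.hom_mult of_int_hom.map_poly_hom_smult)
    moreover have "r = 0 \<or> Polynomial.degree r < Polynomial.degree m"
      using pseudo_mod(2)[OF m(1), of h] by (simp add: r_def)
    ultimately have "r = 0"
      using min[of r] by force
    with aq show ?thesis by auto
  qed
  have prime: "prime_elem f"
    using assms(1) by (rule irreducible_imp_prime_elem)
  obtain a q where aq: "a \<noteq> 0" "Polynomial.smult a f = m * q"
    using multiple assms(3) by blast
  \<comment> \<open>Otherwise \<open>f\<close> divides the cofactor \<open>q\<close>, and cancelling
    \<open>f\<close> makes \<open>m\<close> a divisor of the nonzero constant \<open>a\<close>; but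
    a nonzero constant has no root.\<close>
  have "f dvd m"
  proof (rule ccontr)
    assume "\<not> f dvd m"
    moreover have "f dvd m * q"
      by (simp flip: aq(2) add: dvd_smult)
    ultimately obtain s where "q = f * s"
      using prime by (auto simp: prime_elem_dvd_mult_iff)
    then have "f * [:a:] = f * (m * s)"
      using aq(2) by (simp add: mult_ac)
    then have "[:a:] = m * s"
      using \<open>f \<noteq> 0\<close> by (simp only: mult_cancel_left) simp
    moreover from this have "s \<noteq> 0"
      using aq(1) by auto
    ultimately have "Polynomial.degree m = 0"
      using m(1) degree_mult_eq[of m s] by (metis add_is_0 degree_pCons_0)
    then obtain b where "m = [:b:]" by (rule degree_eq_zeroE)
    with m show False by simp
  qed
  obtain b q' where bq: "b \<noteq> 0" "Polynomial.smult b g = m * q'"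
    using multiple assms(4) by blast
  have "f dvd [:b:] * g"
    using \<open>f dvd m\<close> bq(2) by simp
  moreover have "\<not> f dvd [:b:]"
    using bq(1) assms(2) dvd_imp_degree_le[of f "[:b:]"] by auto
  ultimately show ?thesis
    using prime prime_elem_dvd_multD by blast
qed

section \<open>Rational relations between conjugate roots\<close>

lemma map_poly_of_rat_of_int:
  "map_poly (of_rat :: rat \<Rightarrow> 'a::field_char_0) (map_poly of_int p) = map_poly of_int p"
  by (simp add: poly_eq_iff coeff_map_poly)

lemma rat_poly_common_denominator:
  fixes G :: "rat poly"
  obtains m :: int and g :: "int poly" where "m \<noteq> 0" "Polynomial.smult (of_int m) G = map_poly of_int g"
proof -
  have "\<exists>m g. m \<noteq> 0 \<and> Polynomial.smult (of_int m) G = map_poly of_int g"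
  proof (induction G)
    case 0
    then show ?case by (intro exI[of _ 1] exI[of _ 0]) simp
  next
    case (pCons c G)
    then obtain m g where mg: "m \<noteq> 0" "Polynomial.smult (of_int m) G = map_poly of_int g" by blast
    obtain a b where ab: "b > 0" "c = of_int a / of_int b"
      by (metis quotient_of_denom_pos quotient_of_div surj_pair)
    have "Polynomial.smult (of_int (b * m)) (pCons c G) = map_poly of_int (pCons (m * a) (Polynomial.smult b g))"
      using ab mg by (simp add: of_int_hom.map_poly_pCons_hom of_int_hom.map_poly_hom_smult flip: mg(2))
    moreover have "b * m \<noteq> 0" using ab mg by simp
    ultimately show ?case by blast
  qed
  then show thesis using that by blast
qed

text \<open>Two roots of \<open>f\<close>, possibly in different fields, satisfy the same rational
  equations: after clearing denominators, \<open>f\<close> divides any polynomial that vanishes at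
  one of them.\<close>

lemma rat_poly_root_transfer:
  fixes f :: "int poly" and x :: "'a::field_char_0" and y :: "'b::field_char_0" and G :: "rat poly"
  assumes "Factorial_Ring.irreducible f" "Polynomial.degree f > 0"
    and "poly (map_poly of_int f) x = 0" and "poly (map_poly of_int f) y = 0"
    and "poly (map_poly of_rat G) x = 0"
  shows "poly (map_poly of_rat G) y = 0"
proof -
  obtain m g where mg: "m \<noteq> 0" "Polynomial.smult (of_int m) G = map_poly of_int g"
    by (rule rat_poly_common_denominator)
  have eq: "of_int m * poly (map_poly of_rat G) z = poly (map_poly of_int g) z" for z :: "'c::field_char_0"
  proof -
    have "of_int m * poly (map_poly of_rat G) z = poly (map_poly of_rat (Polynomial.smult (of_int m) G)) z"
      by (simp add: of_rat_hom.map_poly_hom_smult)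
    then show ?thesis by (simp add: mg(2) map_poly_of_rat_of_int)
  qed
  have "poly (map_poly of_int g) x = 0"
    using assms(5) by (simp flip: eq)
  then have "f dvd g"
    by (rule irreducible_int_poly_dvd_if_root[OF assms(1-3)])
  then have "poly (map_poly of_int g) y = 0"
    using assms(4) by (auto simp: dvd_def of_int_poly_hom.hom_mult)
  with mg(1) show ?thesis by (simp flip: eq)
qed

section \<open>Conjugates, interpolation and denominators\<close>

lemma irreducible_int_poly_card_roots:
  fixes f :: "int poly"
  assumes "Factorial_Ring.irreducible f" "Polynomial.degree f > 0"
  shows "card {x :: 'a::{alg_closed_field, field_char_0}. poly (map_poly of_int f) x = 0} = Polynomial.degree f"
proof -
  let ?F = "map_poly of_int f :: 'a poly"
  have "?F \<noteq> 0" using assms by auto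
  then obtain A where A: "size A = Polynomial.degree f"
      "?F = Polynomial.smult (Polynomial.lead_coeff ?F) (\<Prod>x\<in>#A. [:-x, 1:])"
    using alg_closed_imp_factorization[of ?F] by auto
  have roots: "{x. poly ?F x = 0} = set_mset A"
    using \<open>?F \<noteq> 0\<close> by (subst A(2)) (auto simp: poly_prod_mset)
  \<comment> \<open>Separability: a double root would be shared with the derivative, so
    \<open>f\<close> would divide \<open>pderiv f\<close>, which is nonzero and of smaller
    degree.\<close>
  have "count A x = 1" if "x \<in># A" for x
  proof (rule ccontr)
    assume "count A x \<noteq> 1"
    with that have "Suc (Suc 0) \<le> count A x"
      by (metis One_nat_def Suc_leI count_greater_zero_iff le_neq_implies_less)
    then have "{#x, x#} \<subseteq># A"
      by (auto simp: subseteq_mset_def)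
    then obtain B where B: "A = {#x, x#} + B"
      by (metis subset_mset.le_iff_add)
    define Q where "Q = Polynomial.smult (Polynomial.lead_coeff ?F) (\<Prod>x\<in>#B. [:-x, 1:])"
    have F: "?F = [:-x, 1:] * ([:-x, 1:] * Q)"
      by (subst A(2)) (simp add: B Q_def)
    have "poly (map_poly of_int (pderiv f)) x = poly (pderiv ?F) x"
      by (simp add: of_int_hom.map_poly_pderiv)
    also have "\<dots> = 0"
      by (subst F, simp only: pderiv_mult poly_add poly_mult) simp
    finally have "f dvd pderiv f"
      using roots that by (intro irreducible_int_poly_dvd_if_root[OF assms]) auto
    moreover have "pderiv f \<noteq> 0"
      using assms(2) by (simp add: pderiv_eq_0_iff)
    ultimately show False
      using dvd_imp_degree_le[of f "pderiv f"] assms(2) by (simp add: degree_pderiv)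
  qed
  then have "size A = card (set_mset A)"
    by (simp add: size_multiset_overloaded_eq)
  with A roots show ?thesis by simp
qed

text \<open>
  Newton interpolation: \<open>D\<close> is, up to sign, the product of the differences of the points of \<open>S\<close>.
\<close>
lemma algebraic_int_coeffs_if_values:
  fixes S :: "'a::field_char_0 set"
  assumes "finite S" "\<forall>s\<in>S. algebraic_int s"
  shows "\<exists>D. D \<noteq> 0 \<and> algebraic_int D \<and>
    (\<forall>G. (\<forall>k\<ge>card S. Polynomial.coeff G k = 0) \<longrightarrow> (\<forall>s\<in>S. algebraic_int (poly G s))
       \<longrightarrow> (\<forall>k. algebraic_int (D * Polynomial.coeff G k)))"
  using assms
proof (induction S rule: finite_induct)
  case empty
  show ?case by (intro exI[of _ 1]) auto
next
  case (insert a S)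
  have "\<forall>s\<in>S. algebraic_int s"
    using insert.prems by simp
  from insert.IH[OF this] obtain D where D: "D \<noteq> 0" "algebraic_int D"
    and IH: "\<forall>G. (\<forall>k\<ge>card S. Polynomial.coeff G k = 0) \<longrightarrow> (\<forall>s\<in>S. algebraic_int (poly G s))
       \<longrightarrow> (\<forall>k. algebraic_int (D * Polynomial.coeff G k))"
    by (elim exE conjE)
  \<comment> \<open>Splitting off \<open>X - a\<close> divides the values of \<open>G - G(a)\<close>
    at \<open>s\<close> by \<open>s - a\<close>; the factor \<open>E\<close> makes the values of the
    quotient \<open>H\<close> integral again, so that the induction hypothesis applies to
    \<open>E * H\<close>.\<close>
  define E where "E = (\<Prod>s\<in>S. s - a)"
  have E: "E \<noteq> 0" "algebraic_int E"
    using insert by (auto simp: E_def intro!: algebraic_int_prod algebraic_int_diff)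
  have "algebraic_int (D * E * Polynomial.coeff G k)"
    if G: "\<forall>k\<ge>card (insert a S). Polynomial.coeff G k = 0" "\<forall>s\<in>insert a S. algebraic_int (poly G s)" for G k
  proof -
    define H where "H = synthetic_div G a"
    have GH: "G = [:- a, 1:] * H + [:poly G a:]"
      by (simp only: H_def synthetic_div_correct')
    have "Polynomial.coeff H k = 0" if "k \<ge> card S" for k
    proof (cases "H = 0")
      case False
      then have "Polynomial.degree G \<noteq> 0"
        by (simp add: H_def synthetic_div_eq_0_iff)
      moreover have "Polynomial.degree G \<le> card S"
        using G(1) insert.hyps by (intro degree_le) auto
      ultimately show ?thesis
        using that by (intro coeff_eq_0) (simp add: H_def degree_synthetic_div)
    qed simp
    moreover have "algebraic_int (E * poly H s)" if s: "s \<in> S" for s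
    proof -
      have "poly G s = (s - a) * poly H s + poly G a"
        using arg_cong[OF GH, of "\<lambda>p. poly p s"] by (simp add: left_diff_distrib)
      then have "E * poly H s = (\<Prod>s\<in>S - {s}. s - a) * (poly G s - poly G a)"
        using insert.hyps s by (simp add: E_def prod.remove[of S s])
      also have "algebraic_int \<dots>"
        using s G(2) insert.prems
        by (intro algebraic_int_times algebraic_int_prod algebraic_int_diff) auto
      finally show ?thesis .
    qed
    ultimately have H: "algebraic_int (D * E * Polynomial.coeff H k)" for k
      using IH[rule_format, of "Polynomial.smult E H"] by (simp add: mult.assoc)
    \<comment> \<open>Comparing coefficients in \<open>G = X * H - a * H + G(a)\<close> passes
      integrality from \<open>H\<close> back to \<open>G\<close>.\<close>
    have "D * E * Polynomial.coeff G k = D * E * Polynomial.coeff (pCons 0 H) k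
        - a * (D * E * Polynomial.coeff H k) + D * E * Polynomial.coeff [:poly G a:] k"
    proof -
      have "Polynomial.coeff G k = Polynomial.coeff ([:- a, 1:] * H + [:poly G a:]) k"
        using GH by simp
      also have "\<dots> = Polynomial.coeff (pCons 0 H) k - a * Polynomial.coeff H k + Polynomial.coeff [:poly G a:] k"
        by simp
      finally show ?thesis by (simp only: distrib_left right_diff_distrib mult_ac)
    qed
    moreover have "algebraic_int (D * E * Polynomial.coeff (pCons 0 H) k)"
      using H by (cases k) auto
    moreover have "algebraic_int (D * E * Polynomial.coeff [:poly G a:] k)"
      using D E G(2) by (cases k) (auto intro!: algebraic_int_times)
    ultimately show ?thesis
      using H[of k] insert.prems by (auto intro!: algebraic_int_plus algebraic_int_diff algebraic_int_times)
  qed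
  then show ?case
    using D E by (intro exI[of _ "D * E"]) (auto intro: algebraic_int_times)
qed

lemma algebraic_int_of_rat_iff:
  "algebraic_int (of_rat q :: 'a::field_char_0) \<longleftrightarrow> q \<in> \<int>"
proof
  assume "algebraic_int (of_rat q :: 'a)"
  then have "(of_rat q :: 'a) \<in> \<int>"
    by (rule rational_algebraic_int_is_int) simp
  then obtain n where "(of_rat q :: 'a) = of_int n"
    by (auto elim: Ints_cases)
  then have "(of_rat q :: 'a) = of_rat (of_int n)"
    by simp
  then show "q \<in> \<int>"
    by (simp only: of_rat_eq_iff) auto
qed (auto elim: Ints_cases)

text \<open>If \<open>G(x)\<close> is integral, so are its conjugates, and interpolation on the
  roots of \<open>f\<close> bounds the denominators of the coefficients of \<open>G\<close>. The
  bound depends on the roots only, hence \<open>N\<close> serves all \<open>G\<close> at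
  once.\<close>

lemma rat_poly_bounded_denominator:
  fixes f :: "int poly" and x :: "'a::field_char_0"
  assumes "Polynomial.lead_coeff f = 1" "Factorial_Ring.irreducible f" "Polynomial.degree f > 0"
    and "poly (map_poly of_int f) x = 0"
  obtains N :: int where "N \<noteq> 0"
    "\<forall>G k. Polynomial.degree G < Polynomial.degree f \<longrightarrow> algebraic_int (poly (map_poly of_rat G) x)
       \<longrightarrow> of_int N * Polynomial.coeff G k \<in> \<int>"
proof -
  \<comment> \<open>Complex roots are used because the type of \<open>x\<close> need not contain all
    conjugates.\<close>
  define S where "S = {y :: complex. poly (map_poly of_int f) y = 0}"
  have card: "card S = Polynomial.degree f"
    unfolding S_def by (rule irreducible_int_poly_card_roots[OF assms(2,3)])
  have "finite S"
    using card assms(3) by (intro card_ge_0_finite) simp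
  moreover have "\<forall>y\<in>S. algebraic_int y"
    using assms(1) by (auto simp: S_def algebraic_int_altdef_ipoly)
  ultimately have "\<exists>D. D \<noteq> 0 \<and> algebraic_int D \<and>
    (\<forall>G. (\<forall>k\<ge>card S. Polynomial.coeff G k = 0) \<longrightarrow> (\<forall>s\<in>S. algebraic_int (poly G s))
       \<longrightarrow> (\<forall>k. algebraic_int (D * Polynomial.coeff G k)))"
    by (rule algebraic_int_coeffs_if_values)
  then obtain D where D: "D \<noteq> 0" "algebraic_int D"
    "\<forall>G. (\<forall>k\<ge>card S. Polynomial.coeff G k = 0) \<longrightarrow> (\<forall>s\<in>S. algebraic_int (poly G s))
       \<longrightarrow> (\<forall>k. algebraic_int (D * Polynomial.coeff G k))"
    by (elim exE conjE)
  \<comment> \<open>The interpolation denominator \<open>D\<close> is only an algebraic integer; an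
    integral multiple of it is a nonzero integer.\<close>
  obtain s N where N: "N \<noteq> 0" "D * poly (map_poly of_int s) D = of_int N"
    using algebraic_int_divides_int[OF D(2,1)] by metis
  show thesis
  proof (intro that[OF N(1)] allI impI)
    fix G k
    assume G: "Polynomial.degree G < Polynomial.degree f" "algebraic_int (poly (map_poly of_rat G) x)"
    obtain P where P: "poly (map_poly of_int P) (poly (map_poly of_rat G) x) = 0" "Polynomial.lead_coeff P = 1"
      using G(2) unfolding algebraic_int_altdef_ipoly by (elim exE conjE)
    \<comment> \<open>Composition turns the monic equation \<open>P\<close> of \<open>G(x)\<close>
      into a rational equation for \<open>x\<close>, which every conjugate \<open>y\<close>
      satisfies too. So \<open>G(y)\<close> is a root of the same \<open>P\<close>.\<close>
    define Q where "Q = pcompose (map_poly of_int P) G"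
    have Q: "poly (map_poly of_rat Q) z = poly (map_poly of_int P) (poly (map_poly of_rat G) z)"
      for z :: "'c::field_char_0"
      by (simp add: Q_def of_rat_hom.map_poly_pcompose map_poly_of_rat_of_int poly_pcompose)
    have int: "algebraic_int (poly (map_poly of_rat G) y)" if "y \<in> S" for y
    proof -
      have "poly (map_poly of_rat Q) y = 0"
      proof (rule rat_poly_root_transfer[OF assms(2-4)])
        show "poly (map_poly of_int f) y = 0" using that by (simp add: S_def)
        show "poly (map_poly of_rat Q) x = 0" using P(1) by (simp only: Q)
      qed
      with P(2) show ?thesis
        unfolding Q algebraic_int_altdef_ipoly by blast
    qed
    then have "algebraic_int (D * Polynomial.coeff (map_poly of_rat G) k)"
      using G(1) card int by (intro D(3)[rule_format]) (simp_all add: coeff_map_poly coeff_eq_0)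
    from algebraic_int_times[OF algebraic_int_ipoly[OF D(2), of s] this]
    have "algebraic_int (poly (map_poly of_int s) D * (D * of_rat (Polynomial.coeff G k)))"
      by (simp add: coeff_map_poly)
    also have "poly (map_poly of_int s) D * (D * of_rat (Polynomial.coeff G k))
        = (D * poly (map_poly of_int s) D) * of_rat (Polynomial.coeff G k)"
      by (simp only: mult_ac)
    also have "\<dots> = of_rat (of_int N * Polynomial.coeff G k)"
      by (simp add: N(2) of_rat_mult)
    \<comment> \<open>A rational number that is an algebraic integer is an integer.\<close>
    finally show "of_int N * Polynomial.coeff G k \<in> \<int>"
      by (simp only: algebraic_int_of_rat_iff)
  qed
qed

section \<open>The ring of integers and the monogenic order\<close>

lemma ring_of_type_algebra_simps:
  "carrier ring_of_type_algebra = UNIV"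
  "x \<otimes>\<^bsub>ring_of_type_algebra\<^esub> y = x * y"
  "x \<oplus>\<^bsub>ring_of_type_algebra\<^esub> y = x + y"
  "\<one>\<^bsub>ring_of_type_algebra\<^esub> = 1"
  "\<zero>\<^bsub>ring_of_type_algebra\<^esub> = 0"
  by (simp_all add: ring_of_type_algebra_def)

lemma a_inv_ring_of_type_algebra:
  fixes x :: "'a::comm_ring_1"
  shows "\<ominus>\<^bsub>ring_of_type_algebra\<^esub> x = - x"
proof -
  interpret cring "ring_of_type_algebra :: 'a ring" by (rule cring_from_type_algebra)
  show ?thesis by (rule minus_equality) (simp_all add: ring_of_type_algebra_simps)
qed

lemma m_inv_ring_of_type_algebra:
  fixes x :: "'a::Fields.field"
  assumes "x \<noteq> 0"
  shows "inv\<^bsub>ring_of_type_algebra\<^esub> x = inverse x"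
proof -
  interpret cring "ring_of_type_algebra :: 'a ring" by (rule cring_from_type_algebra)
  show ?thesis by (rule inv_char) (use assms in \<open>simp_all add: ring_of_type_algebra_simps\<close>)
qed

section \<open>Elements of the order and of the number field as polynomial values\<close>

lemma monogenic_order_eq:
  "monogenic_order \<theta> = range (\<lambda>g :: int poly. poly (map_poly of_int g) \<theta>)"
proof (intro equalityI subsetI)
  fix x assume "x \<in> monogenic_order \<theta>"
  then show "x \<in> range (\<lambda>g :: int poly. poly (map_poly of_int g) \<theta>)"
    unfolding monogenic_order_def
  proof (induction rule: generate_ring.induct)
    case one
    show ?case by (rule range_eqI[of _ _ 1]) (simp add: ring_of_type_algebra_simps)
  next
    case (incl h)
    then show ?case by (intro range_eqI[of _ _ "[:0, 1:]"]) (simp add: of_int_hom.map_poly_pCons_hom)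
  next
    case (a_inv h)
    then obtain g :: "int poly" where "h = poly (map_poly of_int g) \<theta>" by blast
    then show ?case
      by (intro range_eqI[of _ _ "- g"]) (simp add: a_inv_ring_of_type_algebra of_int_poly_hom.hom_uminus)
  next
    case (eng_add h1 h2)
    then obtain g1 g2 :: "int poly" where "h1 = poly (map_poly of_int g1) \<theta>" "h2 = poly (map_poly of_int g2) \<theta>"
      by blast
    then show ?case
      by (intro range_eqI[of _ _ "g1 + g2"]) (simp add: ring_of_type_algebra_simps of_int_poly_hom.hom_add)
  next
    case (eng_mult h1 h2)
    then obtain g1 g2 :: "int poly" where "h1 = poly (map_poly of_int g1) \<theta>" "h2 = poly (map_poly of_int g2) \<theta>"
      by blast
    then show ?case
      by (intro range_eqI[of _ _ "g1 * g2"]) (simp add: ring_of_type_algebra_simps of_int_poly_hom.hom_mult)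
  qed
next
  have one: "1 \<in> monogenic_order \<theta>"
    using generate_ring.one[of ring_of_type_algebra "{\<theta>}"] by (simp add: monogenic_order_def ring_of_type_algebra_simps)
  have root: "\<theta> \<in> monogenic_order \<theta>"
    by (simp add: monogenic_order_def generate_ring.incl)
  have minus: "- x \<in> monogenic_order \<theta>" if "x \<in> monogenic_order \<theta>" for x
    using that generate_ring.a_inv[of x ring_of_type_algebra "{\<theta>}"]
    by (simp add: monogenic_order_def a_inv_ring_of_type_algebra)
  have add: "x + y \<in> monogenic_order \<theta>" if "x \<in> monogenic_order \<theta>" "y \<in> monogenic_order \<theta>" for x y
    using that generate_ring.eng_add[of x ring_of_type_algebra "{\<theta>}" y]
    by (simp add: monogenic_order_def ring_of_type_algebra_simps)
  have mult: "x * y \<in> monogenic_order \<theta>" if "x \<in> monogenic_order \<theta>" "y \<in> monogenic_order \<theta>" for x y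
    using that generate_ring.eng_mult[of x ring_of_type_algebra "{\<theta>}" y]
    by (simp add: monogenic_order_def ring_of_type_algebra_simps)
  have zero: "0 \<in> monogenic_order \<theta>"
    using add[OF one minus[OF one]] by simp
  have nat: "of_nat k \<in> monogenic_order \<theta>" for k
    by (induction k) (auto intro: zero one add)
  have int: "of_int k \<in> monogenic_order \<theta>" for k
    by (cases k) (auto intro: nat minus simp del: of_nat_Suc)
  fix x assume "x \<in> range (\<lambda>g :: int poly. poly (map_poly of_int g) \<theta>)"
  then obtain g :: "int poly" where "x = poly (map_poly of_int g) \<theta>" by blast
  also have "\<dots> \<in> monogenic_order \<theta>"
    by (induction g) (auto intro: zero int add mult root simp: of_int_hom.map_poly_pCons_hom)
  finally show "x \<in> monogenic_order \<theta>" .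
qed

lemma number_field_closed:
  fixes \<theta> :: "'a::field_char_0"
  shows number_field_1: "1 \<in> number_field \<theta>"
    and number_field_minus: "x \<in> number_field \<theta> \<Longrightarrow> - x \<in> number_field \<theta>"
    and number_field_add: "x \<in> number_field \<theta> \<Longrightarrow> y \<in> number_field \<theta> \<Longrightarrow> x + y \<in> number_field \<theta>"
    and number_field_mult: "x \<in> number_field \<theta> \<Longrightarrow> y \<in> number_field \<theta> \<Longrightarrow> x * y \<in> number_field \<theta>"
  using generate_field.one[of ring_of_type_algebra "{\<theta>}"] generate_field.a_inv[of x ring_of_type_algebra "{\<theta>}"]
    generate_field.eng_add[of x ring_of_type_algebra "{\<theta>}" y] generate_field.eng_mult[of x ring_of_type_algebra "{\<theta>}" y]
  by (simp_all add: number_field_def ring_of_type_algebra_simps a_inv_ring_of_type_algebra)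

lemma monogenic_order_subset_number_field: "monogenic_order \<theta> \<subseteq> number_field \<theta>"
proof
  fix x assume "x \<in> monogenic_order \<theta>"
  then show "x \<in> number_field \<theta>"
    unfolding monogenic_order_def number_field_def
    by (induction rule: generate_ring.induct) (auto intro: generate_field.intros)
qed

text \<open>Only closure under inverses needs an argument: a nonzero integer polynomial in
  \<open>\<theta>\<close> is integral and therefore has a multiple, again by a polynomial in
  \<open>\<theta>\<close>, that is a nonzero integer.\<close>

lemma number_field_subset:
  fixes \<theta> :: "'a::field_char_0"
  assumes "algebraic_int \<theta>"
  shows "number_field \<theta> \<subseteq> range (\<lambda>G :: rat poly. poly (map_poly of_rat G) \<theta>)"
proof
  interpret of_rat_poly_hom: map_poly_comm_ring_hom "of_rat :: rat \<Rightarrow> 'a" ..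
  fix x assume "x \<in> number_field \<theta>"
  then show "x \<in> range (\<lambda>G :: rat poly. poly (map_poly of_rat G) \<theta>)"
    unfolding number_field_def
  proof (induction rule: generate_field.induct)
    case one
    show ?case by (rule range_eqI[of _ _ 1]) (simp add: ring_of_type_algebra_simps)
  next
    case (incl h)
    then show ?case by (intro range_eqI[of _ _ "[:0, 1:]"]) (simp add: of_rat_hom.map_poly_pCons_hom)
  next
    case (a_inv h)
    then obtain G :: "rat poly" where "h = poly (map_poly of_rat G) \<theta>" by blast
    then show ?case
      by (intro range_eqI[of _ _ "- G"]) (simp add: a_inv_ring_of_type_algebra of_rat_poly_hom.hom_uminus)
  next
    case (m_inv h)
    then obtain G :: "rat poly" where G: "h = poly (map_poly of_rat G) \<theta>" and "h \<noteq> 0"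
      by (auto simp: ring_of_type_algebra_simps)
    obtain m g where mg: "m \<noteq> 0" "Polynomial.smult (of_int m) G = map_poly of_int g"
      by (rule rat_poly_common_denominator)
    have "of_int m * h = poly (map_poly of_rat (Polynomial.smult (of_int m) G)) \<theta>"
      by (simp add: G of_rat_hom.map_poly_hom_smult)
    also have "\<dots> = poly (map_poly of_int g) \<theta>"
      by (simp add: mg(2) map_poly_of_rat_of_int)
    finally have h: "of_int m * h = poly (map_poly of_int g) \<theta>" .
    then have "poly (map_poly of_int g) \<theta> \<noteq> 0"
      using mg(1) \<open>h \<noteq> 0\<close> by (metis mult_eq_0_iff of_int_eq_0_iff)
    then obtain s N where N: "N \<noteq> 0"
      "poly (map_poly of_int g) \<theta> * poly (map_poly of_int s) (poly (map_poly of_int g) \<theta>) = of_int N"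
      using algebraic_int_divides_int[OF algebraic_int_ipoly[OF assms]] by metis
    \<comment> \<open>With \<open>z = of_int m * h = g(\<theta>)\<close> and
      \<open>z * s(z) = N\<close>, the inverse of \<open>h\<close> is
      \<open>m * s(z) / N\<close>.\<close>
    define Q :: "rat poly" where "Q = Polynomial.smult (of_int m / of_int N) (map_poly of_int (pcompose s g))"
    have "poly (map_poly of_rat Q) \<theta> = of_int m / of_int N * poly (map_poly of_int s) (of_int m * h)"
      by (simp add: Q_def of_rat_hom.map_poly_hom_smult of_rat_hom.map_poly_pcompose map_poly_of_rat_of_int
          of_int_hom.map_poly_pcompose poly_pcompose h of_rat_divide)
    also have "\<dots> = inverse h"
    proof -
      have "of_int m * h * poly (map_poly of_int s) (of_int m * h) = of_int N"
        using N(2) by (simp only: h)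
      then show ?thesis
        using \<open>h \<noteq> 0\<close> N(1) by (simp add: field_simps)
    qed
    finally show ?case
      using m_inv_ring_of_type_algebra[OF \<open>h \<noteq> 0\<close>] by (intro range_eqI[of _ _ Q]) simp
  next
    case (eng_add h1 h2)
    then obtain g1 g2 :: "rat poly" where "h1 = poly (map_poly of_rat g1) \<theta>" "h2 = poly (map_poly of_rat g2) \<theta>"
      by blast
    then show ?case
      by (intro range_eqI[of _ _ "g1 + g2"]) (simp add: ring_of_type_algebra_simps of_rat_hom.map_poly_hom_add)
  next
    case (eng_mult h1 h2)
    then obtain g1 g2 :: "rat poly" where "h1 = poly (map_poly of_rat g1) \<theta>" "h2 = poly (map_poly of_rat g2) \<theta>"
      by blast
    then show ?case
      by (intro range_eqI[of _ _ "g1 * g2"]) (simp add: ring_of_type_algebra_simps of_rat_poly_hom.hom_mult)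
  qed
qed

lemma monogenic_order_closed:
  shows monogenic_order_of_int: "of_int k \<in> monogenic_order \<theta>"
    and monogenic_order_generator: "\<theta> \<in> monogenic_order \<theta>"
    and monogenic_order_add: "x \<in> monogenic_order \<theta> \<Longrightarrow> y \<in> monogenic_order \<theta> \<Longrightarrow> x + y \<in> monogenic_order \<theta>"
    and monogenic_order_minus: "x \<in> monogenic_order \<theta> \<Longrightarrow> - x \<in> monogenic_order \<theta>"
    and monogenic_order_mult: "x \<in> monogenic_order \<theta> \<Longrightarrow> y \<in> monogenic_order \<theta> \<Longrightarrow> x * y \<in> monogenic_order \<theta>"
proof -
  have poly: "poly (map_poly of_int g) \<theta> \<in> monogenic_order \<theta>" for g
    by (auto simp: monogenic_order_eq)
  show "of_int k \<in> monogenic_order \<theta>"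
    using poly[of "[:k:]"] by (simp add: of_int_hom.map_poly_pCons_hom)
  show "\<theta> \<in> monogenic_order \<theta>"
    using poly[of "[:0, 1:]"] by (simp add: of_int_hom.map_poly_pCons_hom)
  show "- x \<in> monogenic_order \<theta>" if "x \<in> monogenic_order \<theta>"
    using that poly[of "- g" for g] by (auto simp: monogenic_order_eq of_int_poly_hom.hom_uminus)
  show "x + y \<in> monogenic_order \<theta>" if "x \<in> monogenic_order \<theta>" "y \<in> monogenic_order \<theta>"
  proof -
    obtain g h where "x = poly (map_poly of_int g) \<theta>" "y = poly (map_poly of_int h) \<theta>"
      using \<open>x \<in> _\<close> \<open>y \<in> _\<close> by (auto simp: monogenic_order_eq)
    then show ?thesis using poly[of "g + h"] by (simp add: of_int_poly_hom.hom_add)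
  qed
  show "x * y \<in> monogenic_order \<theta>" if "x \<in> monogenic_order \<theta>" "y \<in> monogenic_order \<theta>"
  proof -
    obtain g h where "x = poly (map_poly of_int g) \<theta>" "y = poly (map_poly of_int h) \<theta>"
      using \<open>x \<in> _\<close> \<open>y \<in> _\<close> by (auto simp: monogenic_order_eq)
    then show ?thesis using poly[of "g * h"] by (simp add: of_int_poly_hom.hom_mult)
  qed
qed

section \<open>Ring, subgroup and ideal structure on the integers of the field\<close>

abbreviation integers_of :: "'a::field_char_0 \<Rightarrow> 'a set" where
  "integers_of \<theta> \<equiv> carrier (ring_of_integers (number_field \<theta>))"

lemma ring_of_integers_simps:
  "carrier (ring_of_integers K) = {x \<in> K. algebraic_int x}"
  "x \<otimes>\<^bsub>ring_of_integers K\<^esub> y = x * y"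
  "x \<oplus>\<^bsub>ring_of_integers K\<^esub> y = x + y"
  "\<one>\<^bsub>ring_of_integers K\<^esub> = 1"
  "\<zero>\<^bsub>ring_of_integers K\<^esub> = 0"
  by (simp_all add: ring_of_integers_def ring_of_type_algebra_def)

lemma integers_of_closed:
  fixes \<theta> :: "'a::field_char_0"
  shows integers_of_add: "x \<in> integers_of \<theta> \<Longrightarrow> y \<in> integers_of \<theta> \<Longrightarrow> x + y \<in> integers_of \<theta>"
    and integers_of_minus: "x \<in> integers_of \<theta> \<Longrightarrow> - x \<in> integers_of \<theta>"
    and integers_of_mult: "x \<in> integers_of \<theta> \<Longrightarrow> y \<in> integers_of \<theta> \<Longrightarrow> x * y \<in> integers_of \<theta>"
  by (auto simp: ring_of_integers_simps
      intro: number_field_add number_field_minus number_field_mult algebraic_int_plus algebraic_int_times)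

lemma monogenic_order_subset_integers_of:
  assumes "algebraic_int \<theta>"
  shows "monogenic_order \<theta> \<subseteq> integers_of \<theta>"
  using monogenic_order_subset_number_field[of \<theta>] algebraic_int_ipoly[OF assms]
  by (auto simp: ring_of_integers_simps monogenic_order_eq)

lemma cring_ring_of_integers:
  fixes \<theta> :: "'a::field_char_0"
  shows "cring (ring_of_integers (number_field \<theta>))"
proof (rule cringI)
  have one: "1 \<in> integers_of \<theta>"
    by (simp add: ring_of_integers_simps number_field_1)
  have zero: "0 \<in> integers_of \<theta>"
    using integers_of_add[OF one integers_of_minus[OF one]] by simp
  have inverse: "\<exists>y\<in>integers_of \<theta>. y + x = 0" if "x \<in> integers_of \<theta>" for x
    using integers_of_minus[OF that] by (intro bexI[of _ "- x"]) auto
  show "abelian_group (ring_of_integers (number_field \<theta>))"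
    using zero inverse integers_of_add
    by (intro abelian_groupI) (simp_all only: ring_of_integers_simps(2-) add_ac add_0 add_0_right)
  show "comm_monoid (ring_of_integers (number_field \<theta>))"
    using one integers_of_mult
    by (intro comm_monoidI) (simp_all only: ring_of_integers_simps(2-) mult_ac mult_1 mult_1_right)
qed (simp add: ring_of_integers_simps distrib_right)

lemma minus_ring_of_integers:
  fixes \<theta> :: "'a::field_char_0"
  assumes "x \<in> integers_of \<theta>"
  shows "\<ominus>\<^bsub>ring_of_integers (number_field \<theta>)\<^esub> x = - x"
proof -
  interpret cring "ring_of_integers (number_field \<theta>)" by (rule cring_ring_of_integers)
  show ?thesis
    by (rule minus_equality) (use assms integers_of_minus in \<open>auto simp: ring_of_integers_simps(2-)\<close>)
qed

lemma subgroup_ring_of_integersI: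
  fixes \<theta> :: "'a::field_char_0"
  assumes "S \<subseteq> integers_of \<theta>" "0 \<in> S" "\<And>x y. x \<in> S \<Longrightarrow> y \<in> S \<Longrightarrow> x + y \<in> S" "\<And>x. x \<in> S \<Longrightarrow> - x \<in> S"
  shows "subgroup S (add_monoid (ring_of_integers (number_field \<theta>)))"
proof -
  interpret cring "ring_of_integers (number_field \<theta>)" by (rule cring_ring_of_integers)
  show ?thesis
  proof (rule add.subgroupI)
    show "\<ominus>\<^bsub>ring_of_integers (number_field \<theta>)\<^esub> x \<in> S" if "x \<in> S" for x
      using that assms minus_ring_of_integers by (metis subsetD)
  qed (use assms in \<open>auto simp: ring_of_integers_simps(2-)\<close>)
qed

lemma ideal_ring_of_integersI:
  fixes \<theta> :: "'a::field_char_0"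
  assumes "S \<subseteq> integers_of \<theta>" "0 \<in> S" "\<And>x y. x \<in> S \<Longrightarrow> y \<in> S \<Longrightarrow> x + y \<in> S"
    and mult: "\<And>x y. x \<in> S \<Longrightarrow> y \<in> integers_of \<theta> \<Longrightarrow> y * x \<in> S"
  shows "ideal S (ring_of_integers (number_field \<theta>))"
proof -
  interpret cring "ring_of_integers (number_field \<theta>)" by (rule cring_ring_of_integers)
  have "- 1 \<in> integers_of \<theta>"
    using integers_of_minus[OF one_closed] by (simp add: ring_of_integers_simps)
  then have "- x \<in> S" if "x \<in> S" for x
    using mult[OF that, of "- 1"] by simp
  then show ?thesis
    using assms by (intro idealI subgroup_ring_of_integersI ring_axioms)
      (auto simp: ring_of_integers_simps(2-) mult.commute)
qed

lemma add_pow_ring_of_integers: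
  fixes \<theta> :: "'a::field_char_0"
  shows "[k] \<cdot>\<^bsub>ring_of_integers (number_field \<theta>)\<^esub> x = of_nat k * x"
proof -
  interpret cring "ring_of_integers (number_field \<theta>)" by (rule cring_ring_of_integers)
  show ?thesis
    by (induction k) (simp_all add: ring_of_integers_simps distrib_right add.commute)
qed

section \<open>Maximal ideals and torsion in quotient groups\<close>

text \<open>Zorn's lemma for the ideals above \<open>I\<close>; properness is expressed as
  \<open>\<one> \<notin> J\<close>, a condition that passes to unions of chains.\<close>

lemma (in cring) exists_maximalideal_superset:
  assumes "ideal I R" "\<one> \<notin> I"
  obtains M where "maximalideal M R" "I \<subseteq> M"
proof -
  define \<A> where "\<A> = {J. ideal J R \<and> I \<subseteq> J \<and> \<one> \<notin> J}"
  have "\<exists>M\<in>\<A>. \<forall>Y\<in>\<A>. M \<subseteq> Y \<longrightarrow> Y = M"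
  proof (rule subset_Zorn_nonempty)
    show "\<A> \<noteq> {}"
      using assms by (auto simp: \<A>_def)
    fix C assume C: "C \<noteq> {}" "subset.chain \<A> C"
    then have "C \<subseteq> \<A>"
      by (simp add: subset.chain_def)
    moreover have "subset.chain {J. ideal J R} C"
      using C(2) by (auto simp: subset.chain_def \<A>_def)
    then have "ideal (\<Union>C) R"
      using chain_Union_is_ideal[of C] C(1) by simp
    ultimately show "\<Union>C \<in> \<A>"
      using C(1) by (fastforce simp: \<A>_def)
  qed
  then obtain M where M: "M \<in> \<A>" and max: "\<And>Y. Y \<in> \<A> \<Longrightarrow> M \<subseteq> Y \<Longrightarrow> Y = M"
    by blast
  have "maximalideal M R"
  proof (rule maximalidealI)
    show "ideal M R" "carrier R \<noteq> M"
      using M one_closed unfolding \<A>_def by blast+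
    fix J assume J: "ideal J R" "M \<subseteq> J" "J \<subseteq> carrier R"
    show "J = M \<or> J = carrier R"
    proof (cases "\<one> \<in> J")
      case True
      then show ?thesis using ideal.one_imp_carrier[OF J(1)] by simp
    next
      case False
      then have "J \<in> \<A>" using J M by (auto simp: \<A>_def)
      with max J(2) show ?thesis by blast
    qed
  qed
  moreover have "I \<subseteq> M" using M by (simp add: \<A>_def)
  ultimately show thesis by (rule that)
qed

section \<open>Cauchy's theorem and torsion of quotients\<close>

lemma (in group) cauchy_theorem:
  assumes "finite (carrier G)" "Factorial_Ring.prime p" "p dvd Coset.order G"
  obtains x where "x \<in> carrier G" "x \<noteq> \<one>" "x [^] p = \<one>"
proof -
  \<comment> \<open>Sylow's theorem with exponent 1 yields a subgroup of order exactly
    \<open>p\<close>, and Lagrange's theorem gives \<open>x [^] p = \<one>\<close> for all its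
    elements.\<close>
  obtain m where "Coset.order G = p ^ 1 * m"
    using assms(3) by (auto simp: dvd_def)
  then obtain H where H: "subgroup H G" "card H = p"
    using sylow_thm[OF assms(2) is_group _ assms(1)] by (metis power_one_right)
  interpret H: group "G\<lparr>carrier := H\<rparr>"
    using H(1) by (rule subgroup.subgroup_is_group) (rule is_group)
  have "finite H"
    using H(1) assms(1) by (meson finite_subset subgroup.subset)
  have "\<not> H \<subseteq> {\<one>}"
    using H(2) card_mono[of "{\<one>}" H] prime_gt_1_nat[OF assms(2)] by auto
  then obtain x where x: "x \<in> H" "x \<noteq> \<one>" by blast
  have "x [^]\<^bsub>G\<lparr>carrier := H\<rparr>\<^esub> p = \<one>"
    using H.pow_order_eq_1[of x] x H(2) by (simp add: Coset.order_def)
  then have "x [^] p = \<one>"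
    by (simp flip: nat_pow_consistent)
  then show thesis
    using that x subgroup.mem_carrier[OF H(1)] by blast
qed

lemma (in abelian_subgroup) coset_nat_pow:
  assumes "x \<in> carrier G"
  shows "(H +> x) [^]\<^bsub>G A_Mod H\<^esub> (k :: nat) = H +> ([k] \<cdot> x)"
proof (induction k)
  case 0
  show ?case
    by (simp add: A_FactGroup_def' a_coset_join2[OF zero_closed a_subgroup] additive_subgroup.zero_closed additive_subgroup_axioms)
next
  case (Suc k)
  then show ?case
    using assms by (simp add: a_rcos_sum)
qed

text \<open>Cauchy's theorem in the quotient group gives a nontrivial coset killed by
  \<open>p\<close>; any representative \<open>x\<close> of it is as required.\<close>

lemma (in abelian_subgroup) index_dvd_torsion:
  assumes "finite (a_rcosets H)" "Factorial_Ring.prime p" "p dvd card (a_rcosets H)"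
  obtains x where "x \<in> carrier G" "x \<notin> H" "[p] \<cdot> x \<in> H"
proof -
  interpret Q: group "G A_Mod H"
    by (rule a_factorgroup_is_group)
  have carrier: "carrier (G A_Mod H) = a_rcosets H"
    by (simp add: A_FactGroup_def')
  have one: "\<one>\<^bsub>G A_Mod H\<^esub> = H"
    by (simp add: A_FactGroup_def')
  obtain Y where Y: "Y \<in> a_rcosets H" "Y \<noteq> H" "Y [^]\<^bsub>G A_Mod H\<^esub> p = H"
    using Q.cauchy_theorem[of p] assms unfolding carrier Coset.order_def one by blast
  then obtain x where x: "x \<in> carrier G" "Y = H +> x"
    by (auto simp: A_RCOSETS_def')
  have "x \<notin> H"
    using Y(2) x a_coset_join2[OF _ a_subgroup] by blast
  moreover have "H +> ([p] \<cdot> x) = H"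
    using Y(3) x coset_nat_pow by simp
  then have "[p] \<cdot> x \<in> H"
    using x(1) by (intro a_coset_join1[OF _ _ a_subgroup]) auto
  ultimately show thesis
    using that x(1) by blast
qed

section \<open>Monogenic orders of irreducible polynomials\<close>

locale monogenic =
  fixes f :: "int poly" and \<theta> :: "'a::field_char_0"
  assumes monic: "Polynomial.lead_coeff f = 1"
    and irreducible: "Factorial_Ring.irreducible f"
    and degree_pos: "Polynomial.degree f > 0"
    and root: "poly (map_poly of_int f) \<theta> = 0"
begin

lemma algebraic_int_generator: "algebraic_int \<theta>"
  using monic root unfolding algebraic_int_altdef_ipoly by blast

lemma dvd_if_root: "poly (map_poly of_int g) \<theta> = 0 \<Longrightarrow> f dvd g"
  by (rule irreducible_int_poly_dvd_if_root[OF irreducible degree_pos root])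

section \<open>Bounded denominators and finiteness of the index\<close>

lemma monogenic_order_representative:
  assumes "x \<in> monogenic_order \<theta>"
  obtains g :: "int poly" where "Polynomial.degree g < Polynomial.degree f" "x = poly (map_poly of_int g) \<theta>"
proof -
  obtain h where h: "x = poly (map_poly of_int h) \<theta>"
    using assms by (auto simp: monogenic_order_eq)
  obtain q g where qg: "pseudo_divmod h f = (q, g)"
    by (cases "pseudo_divmod h f")
  have "f \<noteq> 0" using degree_pos by auto
  \<comment> \<open>The factor introduced by pseudo-division is a power of the leading coefficient,
    which is 1.\<close>
  have "h = f * q + g"
    using pseudo_divmod(1)[OF \<open>f \<noteq> 0\<close> qg] monic by simp
  then have "x = poly (map_poly of_int g) \<theta>"
    by (simp add: h of_int_poly_hom.hom_add of_int_poly_hom.hom_mult root)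
  moreover have "Polynomial.degree g < Polynomial.degree f"
    using pseudo_divmod(2)[OF \<open>f \<noteq> 0\<close> qg] degree_pos by auto
  ultimately show thesis using that by blast
qed

lemma integers_of_bounded_denominator:
  obtains N :: int where "N \<noteq> 0" "\<forall>x\<in>integers_of \<theta>. of_int N * x \<in> monogenic_order \<theta>"
proof -
  obtain N :: int where N: "N \<noteq> 0"
    "\<forall>G k. Polynomial.degree G < Polynomial.degree f \<longrightarrow> algebraic_int (poly (map_poly of_rat G) \<theta>)
       \<longrightarrow> of_int N * Polynomial.coeff G k \<in> \<int>"
    by (rule rat_poly_bounded_denominator[OF monic irreducible degree_pos root])
  show thesis
  proof (rule that[OF N(1)], rule ballI)
    interpret of_rat_poly_hom: map_poly_comm_ring_hom "of_rat :: rat \<Rightarrow> 'a" ..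
    fix x assume "x \<in> integers_of \<theta>"
    then have x: "algebraic_int x" "x \<in> number_field \<theta>"
      by (auto simp: ring_of_integers_simps)
    obtain G :: "rat poly" where G: "x = poly (map_poly of_rat G) \<theta>"
      using x(2) number_field_subset[OF algebraic_int_generator] by blast
    define F where "F = (map_poly of_int f :: rat poly)"
    \<comment> \<open>The remainder has the same value at \<open>\<theta>\<close> and degree below
      that of \<open>f\<close>, as the denominator bound requires.\<close>
    define R where "R = G mod F"
    have "F \<noteq> 0" using degree_pos by (auto simp: F_def)
    have "G = F * (G div F) + R"
      by (simp add: R_def)
    from arg_cong[OF this, of "\<lambda>G. poly (map_poly of_rat G) \<theta>"]
    have xR: "x = poly (map_poly of_rat R) \<theta>"
      by (simp only: G of_rat_poly_hom.hom_add of_rat_poly_hom.hom_mult F_def map_poly_of_rat_of_int)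
        (simp add: root)
    have "Polynomial.degree R < Polynomial.degree f"
      using degree_mod_less'[of F G] \<open>F \<noteq> 0\<close> degree_pos by (cases "R = 0") (auto simp: R_def F_def)
    then have int: "of_int N * Polynomial.coeff R k \<in> \<int>" for k
      using N(2) x(1) xR by blast
    define g where "g = map_poly floor (Polynomial.smult (of_int N) R)"
    have "map_poly of_int g = Polynomial.smult (of_int N) R"
      using int by (simp add: g_def poly_eq_iff coeff_map_poly)
    then have "poly (map_poly of_rat (map_poly of_int g)) \<theta> = of_int N * x"
      by (simp add: xR of_rat_hom.map_poly_hom_smult)
    then show "of_int N * x \<in> monogenic_order \<theta>"
      unfolding monogenic_order_eq map_poly_of_rat_of_int by (metis rangeI)
  qed
qed

text \<open>Finiteness of the order modulo \<open>N\<close>, phrased for pigeonhole arguments: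
  \<open>\<phi>\<close> labels an element by the coefficients modulo \<open>N\<close> of a chosen
  representative of degree below that of \<open>f\<close>. Finitely many labels occur, and equal
  labels mean congruent elements.\<close>

lemma monogenic_order_finite_mod:
  fixes N :: int
  assumes "N > 0"
  obtains \<phi> :: "'a \<Rightarrow> nat \<Rightarrow> int" where "finite (\<phi> ` monogenic_order \<theta>)"
    "\<forall>x\<in>monogenic_order \<theta>. \<forall>y\<in>monogenic_order \<theta>. \<phi> x = \<phi> y
       \<longrightarrow> (\<exists>w\<in>monogenic_order \<theta>. x - y = of_int N * w)"
proof -
  let ?n = "Polynomial.degree f"
  have "\<forall>x\<in>monogenic_order \<theta>. \<exists>g :: int poly. Polynomial.degree g < ?n \<and> x = poly (map_poly of_int g) \<theta>"
    by (metis monogenic_order_representative)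
  then obtain g :: "'a \<Rightarrow> int poly" where
    g: "\<And>x. x \<in> monogenic_order \<theta> \<Longrightarrow> Polynomial.degree (g x) < ?n"
       "\<And>x. x \<in> monogenic_order \<theta> \<Longrightarrow> x = poly (map_poly of_int (g x)) \<theta>"
    by metis
  define \<phi> where "\<phi> = (\<lambda>x. restrict (\<lambda>i. Polynomial.coeff (g x) i mod N) {..<?n})"
  have "\<phi> ` monogenic_order \<theta> \<subseteq> {..<?n} \<rightarrow>\<^sub>E {0..<N}"
    using assms by (auto simp: \<phi>_def)
  moreover have "finite ({..<?n} \<rightarrow>\<^sub>E {0..<N})"
    by (intro finite_PiE) auto
  ultimately have "finite (\<phi> ` monogenic_order \<theta>)"
    by (rule finite_subset)
  moreover have "\<exists>w\<in>monogenic_order \<theta>. x - y = of_int N * w"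
    if xy: "x \<in> monogenic_order \<theta>" "y \<in> monogenic_order \<theta>" and eq: "\<phi> x = \<phi> y" for x y
  proof -
    have "N dvd Polynomial.coeff (g x - g y) i" for i
    proof (cases "i < ?n")
      case True
      then have "Polynomial.coeff (g x) i mod N = Polynomial.coeff (g y) i mod N"
        using fun_cong[OF eq, of i] by (simp add: \<phi>_def)
      then show ?thesis by (simp add: mod_eq_dvd_iff)
    next
      case False
      then show ?thesis using g(1)[OF xy(1)] g(1)[OF xy(2)] by (simp add: coeff_eq_0)
    qed
    then obtain h where h: "g x - g y = [:N:] * h"
      by (metis const_poly_dvd_iff dvdE)
    have "x - y = poly (map_poly of_int (g x - g y)) \<theta>"
      using g(2) xy by (simp add: of_int_poly_hom.hom_minus)
    also have "\<dots> = of_int N * poly (map_poly of_int h) \<theta>"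
      by (simp add: h of_int_hom.map_poly_hom_smult)
    finally show ?thesis by (auto simp: monogenic_order_eq)
  qed
  ultimately show thesis using that by blast
qed

lemma abelian_subgroup_monogenic_order:
  "abelian_subgroup (monogenic_order \<theta>) (ring_of_integers (number_field \<theta>))"
proof -
  interpret cring "ring_of_integers (number_field \<theta>)" by (rule cring_ring_of_integers)
  show ?thesis
    using monogenic_order_subset_integers_of[OF algebraic_int_generator] monogenic_order_of_int[of 0 \<theta>]
    by (intro abelian_subgroupI3 additive_subgroupI subgroup_ring_of_integersI abelian_group_axioms)
      (auto intro: monogenic_order_add monogenic_order_minus)
qed

text \<open>Some nonzero \<open>N\<close> carries all integers of the field into the order. If
  \<open>\<bar>N\<bar> * x\<close> and \<open>\<bar>N\<bar> * y\<close> have the same label modulo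
  \<open>\<bar>N\<bar>\<close>, then \<open>x - y\<close> lies in the order, so there are no more
  cosets than labels.\<close>

lemma finite_index:
  "finite (a_rcosets\<^bsub>ring_of_integers (number_field \<theta>)\<^esub> (monogenic_order \<theta>))"
proof -
  interpret abelian_subgroup "monogenic_order \<theta>" "ring_of_integers (number_field \<theta>)"
    by (rule abelian_subgroup_monogenic_order)
  let ?coset = "\<lambda>x. monogenic_order \<theta> +>\<^bsub>ring_of_integers (number_field \<theta>)\<^esub> x"
  obtain N :: int where N: "N \<noteq> 0" "\<forall>x\<in>integers_of \<theta>. of_int N * x \<in> monogenic_order \<theta>"
    by (rule integers_of_bounded_denominator)
  have sgn: "of_int \<bar>N\<bar> * x = of_int (sgn N) * (of_int N * x)" for x :: 'a
    by (simp add: abs_sgn flip: of_int_mult mult.assoc)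
  have N': "of_int \<bar>N\<bar> * x \<in> monogenic_order \<theta>" if "x \<in> integers_of \<theta>" for x
    unfolding sgn by (intro monogenic_order_mult monogenic_order_of_int N(2)[rule_format] that)
  have "\<bar>N\<bar> > 0" using N(1) by simp
  then obtain \<phi> :: "'a \<Rightarrow> nat \<Rightarrow> int" where \<phi>: "finite (\<phi> ` monogenic_order \<theta>)"
    "\<forall>x\<in>monogenic_order \<theta>. \<forall>y\<in>monogenic_order \<theta>. \<phi> x = \<phi> y
       \<longrightarrow> (\<exists>w\<in>monogenic_order \<theta>. x - y = of_int \<bar>N\<bar> * w)"
    by (rule monogenic_order_finite_mod)
  define \<psi> where "\<psi> = (\<lambda>x. \<phi> (of_int \<bar>N\<bar> * x))"
  have "\<psi> ` integers_of \<theta> \<subseteq> \<phi> ` monogenic_order \<theta>"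
    using N' by (auto simp: \<psi>_def)
  then have fin: "finite (\<psi> ` integers_of \<theta>)"
    using \<phi>(1) by (rule finite_subset)
  have same: "?coset x = ?coset y"
    if xy: "x \<in> integers_of \<theta>" "y \<in> integers_of \<theta>" and eq: "\<psi> x = \<psi> y" for x y
  proof -
    obtain w where w: "w \<in> monogenic_order \<theta>" "of_int \<bar>N\<bar> * x - of_int \<bar>N\<bar> * y = of_int \<bar>N\<bar> * w"
      using \<phi>(2) N'[OF xy(1)] N'[OF xy(2)] eq unfolding \<psi>_def by blast
    then have "of_int \<bar>N\<bar> * x = of_int \<bar>N\<bar> * (w + y)"
      by (simp add: algebra_simps)
    then have "x = w + y"
      using N(1) by (simp only: mult_cancel_left of_int_eq_0_iff abs_eq_0_iff) simp
    then have "x \<in> ?coset y"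
      using w(1) by (auto simp: a_r_coset_def' ring_of_integers_simps(2-))
    then show ?thesis
      using a_repr_independence' xy(2) by metis
  qed
  \<comment> \<open>One representative is chosen for each label, so the cosets are the image of the
    finite set of labels.\<close>
  have "?coset x = ?coset (inv_into (integers_of \<theta>) \<psi> (\<psi> x))" if "x \<in> integers_of \<theta>" for x
    using that by (intro same) (auto simp: f_inv_into_f inv_into_into)
  then have "?coset ` integers_of \<theta> \<subseteq> (\<lambda>z. ?coset (inv_into (integers_of \<theta>) \<psi> z)) ` \<psi> ` integers_of \<theta>"
    by blast
  then have "finite (?coset ` integers_of \<theta>)"
    using fin by (meson finite_imageI finite_subset)
  moreover have "a_rcosets\<^bsub>ring_of_integers (number_field \<theta>)\<^esub> (monogenic_order \<theta>) = ?coset ` integers_of \<theta>"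
    by (auto simp: A_RCOSETS_def')
  ultimately show ?thesis by simp
qed

lemma p_maximal_if_no_torsion:
  assumes "Factorial_Ring.prime p"
    and "\<And>x. x \<in> integers_of \<theta> \<Longrightarrow> of_nat p * x \<in> monogenic_order \<theta> \<Longrightarrow> x \<in> monogenic_order \<theta>"
  shows "p_maximal p \<theta>"
  unfolding p_maximal_def order_index_def
proof
  interpret abelian_subgroup "monogenic_order \<theta>" "ring_of_integers (number_field \<theta>)"
    by (rule abelian_subgroup_monogenic_order)
  assume "p dvd card (a_rcosets\<^bsub>ring_of_integers (number_field \<theta>)\<^esub> (monogenic_order \<theta>))"
  from index_dvd_torsion[OF finite_index assms(1) this] obtain x where
    "x \<in> integers_of \<theta>" "x \<notin> monogenic_order \<theta>" "of_nat p * x \<in> monogenic_order \<theta>"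
    by (metis add_pow_ring_of_integers)
  with assms(2) show False by blast
qed

section \<open>Torsion killed by the prime and by \<open>\<theta> - r\<close>\<close>

lemma prime_torsion_in_monogenic_order:
  fixes p :: nat and r :: int
  assumes p: "Factorial_Ring.prime p" and fr: "\<not> (int p)\<^sup>2 dvd poly f r"
    and u: "algebraic_int u" "of_nat p * u \<in> monogenic_order \<theta>" "(\<theta> - of_int r) * u \<in> monogenic_order \<theta>"
  shows "u \<in> monogenic_order \<theta>"
proof -
  have prime: "Factorial_Ring.prime (int p)" using p by simp
  then have "prime_elem [:int p:]"
    by (simp add: prime_elem_const_poly_iff)
  have "p > 0" using p by (simp add: prime_gt_0_nat)
  obtain g where g: "Polynomial.degree g < Polynomial.degree f" "of_nat p * u = poly (map_poly of_int g) \<theta>"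
    using monogenic_order_representative[OF u(2)] .
  obtain h where h: "Polynomial.degree h < Polynomial.degree f" "(\<theta> - of_int r) * u = poly (map_poly of_int h) \<theta>"
    using monogenic_order_representative[OF u(3)] .
  let ?X = "[:-r, 1:]"
  have X: "poly (map_poly of_int ?X) \<theta> = \<theta> - of_int r"
    by (simp add: of_int_hom.map_poly_pCons_hom)
  \<comment> \<open>Both terms of \<open>d\<close> take the value
    \<open>p * (\<theta> - r) * u\<close> at \<open>\<theta>\<close>, so \<open>d\<close> vanishes
    there.\<close>
  define d where "d = ?X * g - [:int p:] * h"
  have "poly (map_poly of_int d) \<theta> = (\<theta> - of_int r) * (of_nat p * u) - of_nat p * ((\<theta> - of_int r) * u)"
    unfolding d_def of_int_poly_hom.hom_minus of_int_poly_hom.hom_mult poly_diff poly_mult X g(2) h(2)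
    by (simp add: of_int_hom.map_poly_pCons_hom)
  then have "f dvd d" by (intro dvd_if_root) simp
  then obtain q where q: "d = f * q" by (rule dvdE)
  have "Polynomial.degree q = 0"
  proof (cases "q = 0")
    case False
    have "Polynomial.degree (?X * g) \<le> Suc (Polynomial.degree g)"
      using degree_mult_le[of ?X g] by simp
    moreover have "Polynomial.degree ([:int p:] * h) \<le> Polynomial.degree h"
      by simp
    ultimately have "Polynomial.degree d \<le> Polynomial.degree f"
      using g(1) h(1) unfolding d_def by (intro degree_diff_le) linarith+
    moreover have "Polynomial.degree d = Polynomial.degree f + Polynomial.degree q"
      using False degree_pos unfolding q by (intro degree_mult_eq) auto
    ultimately show ?thesis by simp
  qed simp
  then obtain c where c: "q = [:c:]" by (rule degree_eq_zeroE)
  show ?thesis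
  proof (cases "int p dvd c")
    case True
    then obtain c' where "c = int p * c'" by (rule dvdE)
    then have "?X * g = [:int p:] * (h + [:c':] * f)"
      using q by (simp add: d_def c algebra_simps smult_add_right)
    then have "[:int p:] dvd ?X * g" by (simp only: dvd_triv_left)
    \<comment> \<open>\<open>X - r\<close> is monic, so the prime constant \<open>p\<close> must
      divide \<open>g\<close>; then \<open>p\<close> cancels in
      \<open>p * u = g(\<theta>)\<close>.\<close>
    moreover have "\<not> [:int p:] dvd ?X"
      using prime not_prime_unit by (auto simp: const_poly_dvd_iff coeff_pCons split: nat.splits)
    ultimately obtain g' where "g = [:int p:] * g'"
      using \<open>prime_elem [:int p:]\<close> by (blast dest: prime_elem_dvd_multD elim: dvdE)
    then have "of_nat p * u = of_nat p * poly (map_poly of_int g') \<theta>"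
      using g(2) by (simp add: of_int_hom.map_poly_hom_smult)
    then show ?thesis
      using \<open>p > 0\<close> by (simp add: monogenic_order_eq)
  next
    case False
    have "poly d r = - int p * poly h r"
      by (simp add: d_def)
    then have eq: "- int p * poly h r = poly f r * c"
      using q c by (simp add: mult.commute)
    then have "int p dvd poly f r * c"
      by (metis dvd_triv_left dvd_minus_iff mult_minus_left)
    then have "int p dvd poly f r"
      using False prime by (simp add: prime_dvd_mult_iff)
    then obtain s where s: "poly f r = int p * s" by (rule dvdE)
    \<comment> \<open>This is where \<open>p\<^sup>2\<close> not dividing \<open>f(r)\<close>
      enters: after cancelling one \<open>p\<close>, the product \<open>s * c\<close>, and with it
      \<open>h(r)\<close>, is prime to \<open>p\<close>.\<close>
    then have "\<not> int p dvd s"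
      using fr by (auto simp: power2_eq_square)
    have "int p * (- poly h r) = int p * (s * c)"
      using eq s by simp
    then have "- poly h r = s * c"
      using \<open>p > 0\<close> by (simp only: mult_cancel_left) simp
    then have "\<not> int p dvd poly h r"
      using \<open>\<not> int p dvd s\<close> False prime by (metis dvd_minus_iff prime_dvd_mult_iff)
    obtain P where P: "poly (map_poly of_int P) u = 0" "Polynomial.lead_coeff P = 1"
      using u(1) unfolding algebraic_int_altdef_ipoly by blast
    define k where "k = Polynomial.degree P"
    \<comment> \<open>The homogenisation of \<open>P\<close> at \<open>h\<close> and
      \<open>X - r\<close>. Since \<open>h(\<theta>) = (\<theta> - r) * u\<close>, its value at
      \<open>\<theta>\<close> is \<open>(\<theta> - r) ^ k * P(u) = 0\<close>.\<close>
    define W where "W = (\<Sum>i\<le>k. [:Polynomial.coeff P i:] * (h ^ i * ?X ^ (k - i)))"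
    have "poly (map_poly of_int W) \<theta> =
        (\<Sum>i\<le>k. of_int (Polynomial.coeff P i) * (((\<theta> - of_int r) * u) ^ i * (\<theta> - of_int r) ^ (k - i)))"
      unfolding W_def of_int_poly_hom.hom_sum of_int_poly_hom.hom_mult of_int_poly_hom.hom_power poly_sum
        poly_mult poly_power X h(2)
      by (simp add: of_int_hom.map_poly_pCons_hom)
    also have "\<dots> = (\<Sum>i\<le>k. (\<theta> - of_int r) ^ k * (of_int (Polynomial.coeff P i) * u ^ i))"
      by (intro sum.cong) (auto simp: power_mult_distrib mult_ac simp flip: power_add)
    also have "\<dots> = 0"
      using P(1) by (simp add: poly_altdef k_def flip: sum_distrib_left)
    finally have "f dvd W" by (rule dvd_if_root)
    then have "poly f r dvd poly W r"
      by (auto simp: dvd_def)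
    \<comment> \<open>At \<open>r\<close> the factor \<open>X - r\<close> vanishes, so only
      \<open>i = k\<close> survives, where \<open>0 ^ 0 = 1\<close> and the coefficient is
      1.\<close>
    have "poly W r = (\<Sum>i\<le>k. Polynomial.coeff P i * (poly h r ^ i * 0 ^ (k - i)))"
      by (simp add: W_def poly_sum)
    also have "\<dots> = (\<Sum>i\<in>{k}. Polynomial.coeff P i * (poly h r ^ i * 0 ^ (k - i)))"
      by (rule sum.mono_neutral_right) auto
    also have "\<dots> = poly h r ^ k"
      using P(2) by (simp add: k_def)
    finally have "int p dvd poly h r ^ k"
      using \<open>int p dvd poly f r\<close> \<open>poly f r dvd poly W r\<close> by (metis dvd_trans)
    then have "int p dvd poly h r"
      using prime prime_dvd_power by blast
    with \<open>\<not> int p dvd poly h r\<close> show ?thesis by simp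
  qed
qed

section \<open>Idempotent powers modulo an integer\<close>

lemma monogenic_order_power: "x \<in> monogenic_order \<theta> \<Longrightarrow> x ^ k \<in> monogenic_order \<theta>"
  using monogenic_order_of_int[of 1 \<theta>] by (induction k) (auto intro: monogenic_order_mult)

text \<open>By pigeonhole the powers of \<open>t\<close> modulo \<open>N\<close> are periodic from
  some exponent \<open>a\<close> on, with period \<open>d\<close>. An exponent that is at least
  \<open>a\<close> and a multiple of \<open>d\<close> can be doubled without changing the
  class.\<close>

lemma exists_idempotent_power:
  fixes N :: int
  assumes "N > 0" and t: "t \<in> monogenic_order \<theta>"
  obtains m w where "m > 0" "w \<in> monogenic_order \<theta>" "t ^ m - t ^ m * t ^ m = of_int N * w"
proof -
  obtain \<phi> :: "'a \<Rightarrow> nat \<Rightarrow> int" where \<phi>: "finite (\<phi> ` monogenic_order \<theta>)"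
    "\<forall>x\<in>monogenic_order \<theta>. \<forall>y\<in>monogenic_order \<theta>. \<phi> x = \<phi> y
       \<longrightarrow> (\<exists>w\<in>monogenic_order \<theta>. x - y = of_int N * w)"
    using monogenic_order_finite_mod[OF assms(1)] by blast
  have "range (\<lambda>k. \<phi> (t ^ k)) \<subseteq> \<phi> ` monogenic_order \<theta>"
    using monogenic_order_power[OF t] by blast
  then have "\<not> inj (\<lambda>k. \<phi> (t ^ k))"
    using \<phi>(1) by (metis finite_imageD finite_subset infinite_UNIV_nat)
  then obtain a b where "a < b" and same: "\<phi> (t ^ a) = \<phi> (t ^ b)"
    by (metis injI linorder_neqE_nat)
  define d where "d = b - a"
  have "d > 0" "b = a + d" using \<open>a < b\<close> by (auto simp: d_def)
  obtain w0 where w0: "w0 \<in> monogenic_order \<theta>" "t ^ a - t ^ b = of_int N * w0"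
    using \<phi>(2) same monogenic_order_power[OF t] by blast
  have periodic: "\<exists>w\<in>monogenic_order \<theta>. t ^ (a + i) - t ^ (a + i + j * d) = of_int N * w" for i j
  proof (induction j)
    case 0
    show ?case using monogenic_order_of_int[of 0 \<theta>] by auto
  next
    case (Suc j)
    then obtain w where w: "w \<in> monogenic_order \<theta>" "t ^ (a + i) - t ^ (a + i + j * d) = of_int N * w"
      by blast
    have "t ^ (a + i) - t ^ (a + i + Suc j * d)
        = (t ^ (a + i) - t ^ (a + i + j * d)) + t ^ (i + j * d) * (t ^ a - t ^ b)"
      by (simp add: \<open>b = a + d\<close> power_add algebra_simps)
    also have "\<dots> = of_int N * (w + t ^ (i + j * d) * w0)"
      unfolding w(2) w0(2) by (simp only: distrib_left mult_ac)
    finally show ?case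
      using w(1) w0(1) monogenic_order_power[OF t] by (blast intro: monogenic_order_add monogenic_order_mult)
  qed
  \<comment> \<open>Taking \<open>Suc a\<close> instead of \<open>a\<close> keeps \<open>m\<close>
    positive even for \<open>a = 0\<close>; \<open>m\<close> is the shift by \<open>Suc a\<close>
    periods and is at least \<open>a\<close>.\<close>
  define m where "m = Suc a * d"
  have "m > 0" using \<open>d > 0\<close> by (simp add: m_def)
  have "a \<le> m" using \<open>d > 0\<close> by (cases d) (auto simp: m_def)
  then have "a + (m - a) = m" by simp
  with periodic[of "m - a" "Suc a"] obtain w where
    "w \<in> monogenic_order \<theta>" "t ^ m - t ^ (m + m) = of_int N * w"
    by (auto simp: m_def)
  then show thesis
    using that \<open>m > 0\<close> by (simp add: power_add)
qed

section \<open>The conductor and the absence of torsion\<close>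

lemma conductor_mult:
  assumes "c \<in> conductor \<theta>" "y \<in> integers_of \<theta>"
  shows "c * y \<in> monogenic_order \<theta>"
  using assms by (auto simp: conductor_def)

lemma conductor_subset: "conductor \<theta> \<subseteq> integers_of \<theta>"
  by (auto simp: conductor_def)

lemma conductor_ideal:
  shows conductor_0: "0 \<in> conductor \<theta>"
    and conductor_add: "x \<in> conductor \<theta> \<Longrightarrow> y \<in> conductor \<theta> \<Longrightarrow> x + y \<in> conductor \<theta>"
    and conductor_absorb: "x \<in> conductor \<theta> \<Longrightarrow> z \<in> integers_of \<theta> \<Longrightarrow> z * x \<in> conductor \<theta>"
proof -
  have zero: "0 \<in> monogenic_order \<theta>"
    using monogenic_order_of_int[of 0 \<theta>] by simp
  with monogenic_order_subset_integers_of[OF algebraic_int_generator]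
  show "0 \<in> conductor \<theta>"
    unfolding conductor_def by auto
  show "x + y \<in> conductor \<theta>" if "x \<in> conductor \<theta>" "y \<in> conductor \<theta>"
    using that unfolding conductor_def by (auto simp: distrib_right simp del: ring_of_integers_simps
        intro: integers_of_add monogenic_order_add)
  show "z * x \<in> conductor \<theta>" if "x \<in> conductor \<theta>" "z \<in> integers_of \<theta>"
  proof -
    have "z * x * y \<in> monogenic_order \<theta>" if y: "y \<in> integers_of \<theta>" for y
      using conductor_mult[OF \<open>x \<in> _\<close> integers_of_mult[OF \<open>z \<in> _\<close> y]] by (simp add: mult_ac)
    then show ?thesis
      using that integers_of_mult unfolding conductor_def by auto
  qed
qed

text \<open>Since the conductor is an ideal of the ring of integers, the congruence of
  \<open>e\<close> to \<open>P * y\<close> modulo it may be raised to the power \<open>j\<close>.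
  This moves membership from the conductor plus multiples of \<open>P\<close> to the conductor plus
  multiples of \<open>P ^ j\<close>.\<close>

lemma power_in_conductor_plus:
  assumes "c \<in> conductor \<theta>" "y \<in> integers_of \<theta>" "P \<in> integers_of \<theta>" "e = c + P * y"
  shows "\<exists>c\<in>conductor \<theta>. \<exists>y\<in>integers_of \<theta>. e ^ j = c + P ^ j * y"
proof (induction j)
  case 0
  have "1 \<in> integers_of \<theta>"
    by (simp add: ring_of_integers_simps number_field_1)
  then show ?case using conductor_0 by force
next
  case (Suc j)
  then obtain c' y' where *: "c' \<in> conductor \<theta>" "y' \<in> integers_of \<theta>" "e ^ j = c' + P ^ j * y'" by blast
  have P: "P ^ j \<in> integers_of \<theta>"
  proof (induction j)
    case 0
    show ?case by (simp add: ring_of_integers_simps number_field_1)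
  next
    case (Suc j)
    then show ?case using integers_of_mult[OF assms(3)] by simp
  qed
  have e: "e \<in> integers_of \<theta>"
    using assms conductor_subset by (auto intro!: integers_of_add integers_of_mult)
  have "e ^ Suc j = e * c' + (P ^ j * y') * e"
    by (simp add: *(3) algebra_simps)
  also have "\<dots> = (e * c' + (P ^ j * y') * c) + P ^ Suc j * (y * y')"
    by (subst (2) assms(4)) (simp add: algebra_simps)
  finally have "e ^ Suc j = (e * c' + (P ^ j * y') * c) + P ^ Suc j * (y * y')" .
  moreover have "e * c' + (P ^ j * y') * c \<in> conductor \<theta>"
    using * e P assms by (intro conductor_add conductor_absorb integers_of_mult)
  ultimately show ?case
    using integers_of_mult[OF assms(2) *(2)] by blast
qed

lemma torsion_free_if_maximalideals_contain:
  fixes p :: nat and r :: int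
  assumes p: "Factorial_Ring.prime p" and fr: "\<not> (int p)\<^sup>2 dvd poly f r"
    and max: "\<And>M. maximalideal M (ring_of_integers (number_field \<theta>)) \<Longrightarrow>
           conductor \<theta> \<subseteq> M \<Longrightarrow> of_nat p \<in> M \<Longrightarrow> \<theta> - of_int r \<in> M"
    and x: "x \<in> integers_of \<theta>" "of_nat p * x \<in> monogenic_order \<theta>"
  shows "x \<in> monogenic_order \<theta>"
proof -
  let ?O = "ring_of_integers (number_field \<theta>)"
  let ?A = "monogenic_order \<theta>"
  interpret cring ?O by (rule cring_ring_of_integers)
  define t where "t = \<theta> - of_int r"
  have "?A \<subseteq> carrier ?O"
    by (rule monogenic_order_subset_integers_of[OF algebraic_int_generator])
  have int_A: "of_int k \<in> ?A" for k
    by (rule monogenic_order_of_int)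
  then have int_O: "of_int k \<in> carrier ?O" for k
    using \<open>?A \<subseteq> _\<close> by blast
  have nat_O: "of_nat k \<in> carrier ?O" for k
    using int_O[of "int k"] by simp
  have one_O: "1 \<in> carrier ?O" and zero_O: "0 \<in> carrier ?O"
    using int_O[of 1] int_O[of 0] by simp_all
  have "t \<in> ?A"
    using monogenic_order_add[OF monogenic_order_generator int_A[of "- r"]] by (simp add: t_def)
  have pow_A: "t ^ k \<in> ?A" for k
    by (rule monogenic_order_power[OF \<open>t \<in> ?A\<close>])
  then have pow_O: "t ^ k \<in> carrier ?O" for k
    using \<open>?A \<subseteq> _\<close> by blast
  have "int p > 0" using p by (simp add: prime_gt_0_nat)
  obtain m w where mw: "m > 0" "w \<in> ?A" "t ^ m - t ^ m * t ^ m = of_int (int p) * w"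
    by (rule exists_idempotent_power[OF \<open>int p > 0\<close> \<open>t \<in> ?A\<close>])
  define e where "e = t ^ m"
  have e_O: "e \<in> carrier ?O" by (simp add: e_def pow_O)
  have e1_O: "1 - e \<in> carrier ?O"
    using integers_of_add[OF one_O integers_of_minus[OF e_O]] by simp
  have ee: "e - e * e = of_nat p * w" using mw(3) by (simp add: e_def)
  have w_O: "w \<in> carrier ?O" using mw(2) \<open>?A \<subseteq> _\<close> by blast
  define I where "I = {c + of_nat p * y + (1 - e) * z |c y z. c \<in> conductor \<theta> \<and> y \<in> carrier ?O \<and> z \<in> carrier ?O}"
  have I: "c + of_nat p * y + (1 - e) * z \<in> I" if "c \<in> conductor \<theta>" "y \<in> carrier ?O" "z \<in> carrier ?O" for c y z
    using that unfolding I_def by blast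
  have ideal: "ideal I ?O"
  proof (rule ideal_ring_of_integersI)
    show "I \<subseteq> carrier ?O"
    proof
      fix v assume "v \<in> I"
      then obtain c y z where v: "v = c + of_nat p * y + (1 - e) * z"
        and "c \<in> conductor \<theta>" "y \<in> carrier ?O" "z \<in> carrier ?O"
        unfolding I_def by blast
      with conductor_subset show "v \<in> carrier ?O"
        unfolding v by (intro integers_of_add integers_of_mult nat_O e1_O) blast+
    qed
    show "0 \<in> I" using I[OF conductor_0 zero_O zero_O] by simp
    show "v + v' \<in> I" if "v \<in> I" "v' \<in> I" for v v'
    proof -
      obtain c y z where v: "v = c + of_nat p * y + (1 - e) * z"
        "c \<in> conductor \<theta>" "y \<in> carrier ?O" "z \<in> carrier ?O"
        using \<open>v \<in> I\<close> unfolding I_def by blast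
      obtain c' y' z' where v': "v' = c' + of_nat p * y' + (1 - e) * z'"
        "c' \<in> conductor \<theta>" "y' \<in> carrier ?O" "z' \<in> carrier ?O"
        using \<open>v' \<in> I\<close> unfolding I_def by blast
      have "v + v' = (c + c') + of_nat p * (y + y') + (1 - e) * (z + z')"
        by (simp add: v(1) v'(1) algebra_simps)
      also have "\<dots> \<in> I"
        using v v' by (intro I conductor_add integers_of_add)
      finally show ?thesis .
    qed
    show "b * v \<in> I" if "v \<in> I" and b: "b \<in> carrier ?O" for v b
    proof -
      obtain c y z where v: "v = c + of_nat p * y + (1 - e) * z"
        "c \<in> conductor \<theta>" "y \<in> carrier ?O" "z \<in> carrier ?O"
        using \<open>v \<in> I\<close> unfolding I_def by blast
      have "b * v = (b * c) + of_nat p * (b * y) + (1 - e) * (b * z)"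
        by (simp add: v(1) algebra_simps)
      also have "\<dots> \<in> I"
        using v b by (intro I conductor_absorb integers_of_mult)
      finally show ?thesis .
    qed
  qed
  have "1 \<in> I"
  proof (rule ccontr)
    assume "1 \<notin> I"
    then obtain M where M: "maximalideal M ?O" "I \<subseteq> M"
      using exists_maximalideal_superset[OF ideal] unfolding ring_of_integers_simps by blast
    interpret M: maximalideal M ?O by (rule M(1))
    have "c \<in> M" if "c \<in> conductor \<theta>" for c
      using I[OF that zero_O zero_O] M(2) by auto
    moreover have "of_nat p \<in> M"
      using I[OF conductor_0 one_O zero_O] M(2) by auto
    ultimately have "t \<in> M"
      unfolding t_def using max[OF M(1)] by blast
    \<comment> \<open>Positivity of \<open>m\<close> makes \<open>e\<close> a multiple of
      \<open>t\<close>, so \<open>e\<close> lies in \<open>M\<close> together with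
      \<open>1 - e\<close>, which is impossible.\<close>
    have "e = t ^ (m - 1) * t"
      unfolding e_def using mw(1) by (rule power_minus_mult[symmetric])
    then have "e \<in> M"
      using M.I_l_closed[OF \<open>t \<in> M\<close> pow_O] by (simp add: ring_of_integers_simps(2-))
    moreover have "1 - e \<in> M"
      using I[OF conductor_0 zero_O one_O] M(2) by auto
    ultimately have "e + (1 - e) \<in> M"
      using M.a_closed by (simp only: ring_of_integers_simps(2-))
    then have "M = carrier ?O"
      by (intro M.one_imp_carrier) (simp add: ring_of_integers_simps(2-))
    with M.I_notcarr show False by simp
  qed
  then obtain c y z where cyz: "1 = c + of_nat p * y + (1 - e) * z"
    "c \<in> conductor \<theta>" "y \<in> carrier ?O" "z \<in> carrier ?O"
    unfolding I_def by blast
  \<comment> \<open>Multiplying the representation of 1 by \<open>e\<close> turns the coefficient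
    \<open>1 - e\<close> into \<open>e - e * e = p * w\<close>, so the last term joins the multiples
    of \<open>p\<close>.\<close>
  have "e = e * (c + of_nat p * y + (1 - e) * z)"
    by (simp flip: cyz(1))
  also have "\<dots> = e * c + of_nat p * (e * y) + (e - e * e) * z"
    by (simp add: algebra_simps)
  also have "\<dots> = e * c + of_nat p * (e * y + w * z)"
    unfolding ee by (simp add: algebra_simps)
  finally have e: "e = e * c + of_nat p * (e * y + w * z)" .
  have pow_e: "\<exists>c\<in>conductor \<theta>. \<exists>y\<in>carrier ?O. e ^ j = c + of_nat p ^ j * y" for j
    using cyz e_O w_O nat_O
    by (intro power_in_conductor_plus[OF _ _ _ e] conductor_absorb integers_of_add integers_of_mult)

  have prime: "Factorial_Ring.prime (int p)" using p by simp
  obtain N :: int where N: "N \<noteq> 0" "\<forall>x\<in>carrier ?O. of_int N * x \<in> ?A"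
    by (rule integers_of_bounded_denominator)
  define j where "j = multiplicity (int p) N"
  \<comment> \<open>\<open>N\<close> is split into its \<open>p\<close>-part and a factor
    \<open>d\<close> prime to \<open>p\<close>.\<close>
  obtain d where d: "N = int p ^ j * d" "\<not> int p dvd d"
    unfolding j_def using N(1) prime not_prime_unit by (metis multiplicity_decompose')
  obtain c' y' where ej: "c' \<in> conductor \<theta>" "y' \<in> carrier ?O" "e ^ j = c' + of_nat p ^ j * y'"
    using pow_e by blast
  \<comment> \<open>The factor \<open>d\<close> completes \<open>p ^ j\<close> to \<open>N\<close>:
    in \<open>e ^ j * u\<close> the conductor part goes into the order, and the other part is
    \<open>N\<close> times an integer of the field.\<close>
  define u where "u = of_int d * x"
  have "e ^ j * u = of_int d * (c' * x) + of_int N * (y' * x)"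
    by (simp add: ej(3) u_def d(1) algebra_simps)
  also have "\<dots> \<in> ?A"
    using conductor_mult[OF ej(1) x(1)] N(2) integers_of_mult[OF ej(2) x(1)]
    by (blast intro: monogenic_order_add monogenic_order_mult[OF int_A])
  finally have "t ^ (m * j) * u \<in> ?A"
    by (simp add: e_def power_mult)
  moreover have u: "u \<in> carrier ?O" "of_nat p * u \<in> ?A"
    using integers_of_mult[OF int_O x(1)] monogenic_order_mult[OF int_A x(2)]
    by (simp_all add: u_def mult_ac)
  \<comment> \<open>Descent on the exponent: \<open>t * v\<close> is again a
    \<open>p\<close>-torsion element and needs one power of \<open>t\<close> less. Once
    \<open>t * v\<close> lies in the order, the case killed by both \<open>p\<close> and
    \<open>t\<close> gives \<open>v\<close>.\<close>
  moreover have "v \<in> ?A" if "t ^ k * v \<in> ?A" "v \<in> carrier ?O" "of_nat p * v \<in> ?A" for k v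
    using that
  proof (induction k arbitrary: v)
    case (Suc k)
    have "t * v \<in> ?A"
    proof (rule Suc.IH)
      show "t ^ k * (t * v) \<in> ?A" using Suc.prems(1) by (simp add: mult_ac)
      show "t * v \<in> carrier ?O" using integers_of_mult[OF pow_O[of 1] Suc.prems(2)] by simp
      show "of_nat p * (t * v) \<in> ?A"
        using monogenic_order_mult[OF \<open>t \<in> ?A\<close> Suc.prems(3)] by (simp add: mult_ac)
    qed
    moreover have "algebraic_int v"
      using Suc.prems(2) by (simp add: ring_of_integers_simps)
    ultimately show ?case
      using prime_torsion_in_monogenic_order[OF p fr _ Suc.prems(3)] unfolding t_def by blast
  qed simp
  ultimately have "u \<in> ?A" by blast
  \<comment> \<open>By Bezout, \<open>x\<close> is an integer combination of \<open>d * x\<close>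
    and \<open>p * x\<close>, both of which lie in the order.\<close>
  have "gcd d (int p) = 1"
    using prime_imp_coprime[OF prime d(2)] by (simp add: coprime_iff_gcd_eq_1 gcd.commute)
  then obtain a b where "a * d + b * int p = 1"
    using bezout_int[of d "int p"] by auto
  from arg_cong[OF this, of "of_int :: int \<Rightarrow> 'a"]
  have ab: "of_int a * of_int d + of_int b * of_nat p = (1 :: 'a)" by simp
  have "x = (of_int a * of_int d + of_int b * of_nat p) * x"
    by (simp add: ab)
  also have "\<dots> = of_int a * u + of_int b * (of_nat p * x)"
    by (simp add: u_def algebra_simps)
  also have "\<dots> \<in> ?A"
    using \<open>u \<in> ?A\<close> x(2) by (intro monogenic_order_add monogenic_order_mult[OF int_A])
  finally show ?thesis .
qed

end

theorem theorem3p1: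
  fixes f :: "int poly" and \<theta> :: "'a::field_char_0" and p :: nat and r :: int
  assumes "Polynomial.lead_coeff f = 1" and "Factorial_Ring.irreducible f" and "Polynomial.degree f \<ge> 2"
    and "poly (map_poly of_int f) \<theta> = 0"
    and "Factorial_Ring.prime p"
    and "\<not> (int p)\<^sup>2 dvd poly f r"
    and "\<not> int p dvd poly (pderiv (pderiv f)) r"
    and "\<And>M. maximalideal M (ring_of_integers (number_field \<theta>)) \<Longrightarrow>
           conductor \<theta> \<subseteq> M \<Longrightarrow> of_nat p \<in> M \<Longrightarrow> \<theta> - of_int r \<in> M"
  shows "p_maximal p \<theta>"
proof -
  interpret monogenic f \<theta>
    using assms(1-4) by unfold_locales auto
  show ?thesis
    using assms(5) torsion_free_if_maximalideals_contain[OF assms(5,6,8)]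
    by (rule p_maximal_if_no_torsion)
qed

end
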